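(* Let $X$ be a nilpotent element in $\mathfrak{sp}(n,\mathbb{R})$, let $\mathbf{d}=[d_1^{t_{d_1}},\dots,d_s^{t_{d_s}}]\in\mathcal{P}(2n)$ be the partition associated with $X$, and let $\mathbb{E}_{\mathbf d}$ be the set of even parts $d_i$. For $\eta\in\mathbb{E}_{\mathbf d}$ let $p_\eta$ and $q_\eta$ be the numbers of $+1$'s and $-1$'s in the first column of the $t_\eta\times\eta$ block of the signed Young diagram of $X$. Then the following statements are equivalent: (1) $X$ is real (with respect to $\mathrm{Sp}(n,\mathbb{R})$). (2) $X$ is strongly real (with respect to $\mathrm{Sp}(n,\mathbb{R})$). (3) $p_\eta=q_\eta=t_\eta/2$ for all $\eta\in\mathbb{E}_{\mathbf d}$.
   Context: For a Lie group $G$ with Lie algebra $\mathfrak{g}$, $X\in\mathfrak{g}$ is real ($\mathrm{Ad}_G$-real) if $-X=\mathrm{Ad}(g)X$ for some $g\in G$, and strongly real if $-X=\mathrm{Ad}(\tau)X$ for some $\tau\in G$ with $\tau^2=\mathrm{Id}$. Let $\mathrm{J}_n=\begin{pmatrix}0&-\mathrm{I}_n\\ \mathrm{I}_n&0\end{pmatrix}$ and $\langle x,y\rangle=x^t\mathrm{J}_n y$ on $V=\mathbb{R}^{2n}$. $\mathrm{Sp}(n,\mathbb{R})=\{g\in\mathrm{SL}_{2n}(\mathbb{R})\mid g^t\mathrm{J}_ng=\mathrm{J}_n\}$, $\mathfrak{sp}(n,\mathbb{R})=\{z\in\mathfrak{sl}_{2n}(\mathbb{R})\mid z^t\mathrm{J}_n+\mathrm{J}_nz=0\}$.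 $\mathcal{P}(m)$ is the set of partitions of $m$, written $[d_1^{t_{d_1}},\dots,d_s^{t_{d_s}}]$ with $d_1>\dots>d_s>0$, $t_{d_i}\geq 1$ and $\sum_i t_{d_i}d_i=m$. The partition $\mathbf d$ of $X$ is given by its Jordan block sizes ($t_d$ is the number of blocks of size $d$). If $X\ne0$, choose an $\mathfrak{sl}_2$-triple $\{X,H,Y\}\subset\mathfrak{sp}(n,\mathbb{R})$ ($[H,X]=2X$, $[H,Y]=-2Y$, $[X,Y]=H$). Let $M(d-1)$ be the sum of all irreducible $\mathrm{Span}_{\mathbb{R}}\{X,H,Y\}$-submodules of $V$ of real dimension $d$, and $L(d-1)=\ker Y\cap M(d-1)$; then $t_d=\dim_{\mathbb{R}}L(d-1)$. For each even part $\eta$, $L(\eta-1)$ has a basis $v^\eta_1,\dots,v^\eta_{t_\eta}$ with $\langle v^\eta_j,X^{\eta-1}v^\eta_k\rangle=0$ for $j\neq k$ and $\langle v^\eta_j,X^{\eta-1}v^\eta_j\rangle=\pm1$. Then $p_\eta=\#\{j\mid\langle v^\eta_j,X^{\eta-1}v^\eta_j\rangle=1\}$ and $q_\eta=t_\eta-p_\eta$; these numbers depend only on the $\mathrm{Sp}(n,\mathbb{R})$-orbit of $X$. The signed Young diagram of $X$ has $+1$ in $p_\eta$ boxes and $-1$ in $q_\eta$ boxes of the first column of the rectangular block of size $t_\eta\times\eta$ for even $\eta$. If $X=0$ then $\mathbb{E}_{\mathbf d}=\emptyset$ and condition (3) is vacuous. *)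

theory Defs
  imports "Jordan_Normal_Form.Jordan_Normal_Form" "HOL-Analysis.Analysis" "HOL-Library.Multiset"
begin

text \<open>
  With \<open>n = CARD('n)\<close>, the space of real column vectors of length \<open>2n\<close> is \<open>real ^ ('n + 'n)\<close>:
  the indices \<open>Inl i\<close> are the first \<open>n\<close> coordinates, the indices \<open>Inr i\<close> the last \<open>n\<close>.
  Jordan normal forms come from the AFP matrices (type \<open>'a mat\<close>), which share several names with
  the matrices and vectors of HOL-Analysis; the latter are meant throughout, except in
  \<open>to_mat\<close> and \<open>jordan_partition\<close>.
\<close>

definition sympJ :: "real ^ ('n::finite + 'n) ^ ('n + 'n)" where
  "sympJ = (\<chi> i j. case (i, j) of
      (Inl a, Inr b) \<Rightarrow> (if a = b then - 1 else 0)
    | (Inr a, Inl b) \<Rightarrow> (if a = b then 1 else 0)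
    | _ \<Rightarrow> 0)"

definition symp_form :: "real ^ ('n::finite + 'n) \<Rightarrow> real ^ ('n + 'n) \<Rightarrow> real" where
  "symp_form x y = inner x (sympJ *v y)"

definition Sp :: "(real ^ ('n::finite + 'n) ^ ('n + 'n)) set" where
  "Sp = {g. Determinants.det g = 1 \<and> Finite_Cartesian_Product.transpose g ** sympJ ** g = sympJ}"

definition sp :: "(real ^ ('n::finite + 'n) ^ ('n + 'n)) set" where
  "sp = {z. Determinants.trace z = 0 \<and>
            Finite_Cartesian_Product.transpose z ** sympJ + sympJ ** z = 0}"

text \<open>For a matrix group, \<open>Ad(g) X = g X g\<^sup>-\<^sup>1\<close>.\<close>

definition Ad :: "real ^ 'm ^ 'm \<Rightarrow> real ^ 'm ^ 'm \<Rightarrow> real ^ 'm ^ 'm" where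
  "Ad g X = g ** X ** matrix_inv g"

definition Ad_real :: "(real ^ 'm ^ 'm) set \<Rightarrow> real ^ 'm ^ 'm \<Rightarrow> bool" where
  "Ad_real G X \<longleftrightarrow> (\<exists>g\<in>G. - X = Ad g X)"

definition strongly_Ad_real :: "(real ^ 'm ^ 'm) set \<Rightarrow> real ^ 'm ^ 'm \<Rightarrow> bool" where
  "strongly_Ad_real G X \<longleftrightarrow> (\<exists>\<tau>\<in>G. \<tau> ** \<tau> = Finite_Cartesian_Product.mat 1 \<and> - X = Ad \<tau> X)"

text \<open>
  The powers \<open>X ^ k\<close> and the product \<open>X * Y\<close> of HOL-Analysis matrices are taken entrywise,
  so the powers of the matrix are written as iterates.
\<close>

definition nilpotent_matrix :: "real ^ 'm ^ 'm \<Rightarrow> bool" where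
  "nilpotent_matrix X \<longleftrightarrow> (\<exists>k. (((**) X) ^^ k) (Finite_Cartesian_Product.mat 1) = 0)"

text \<open>
  The same matrix as an AFP matrix, for the enumeration \<open>from_nat_into UNIV\<close> of the index type by
  \<open>{0..<CARD('m)}\<close>.  Another enumeration gives a similar matrix, hence the same Jordan blocks.
\<close>

definition to_mat :: "real ^ 'm ^ 'm \<Rightarrow> real Matrix.mat" where
  "to_mat X = Matrix.mat CARD('m) CARD('m)
     (\<lambda>(i, j). vec_nth (vec_nth X (from_nat_into UNIV i)) (from_nat_into UNIV j))"

text \<open>
  The multiset of the sizes of the Jordan blocks of \<open>X\<close>; \<open>count (jordan_partition X) d\<close> is the
  multiplicity \<open>t\<^sub>d\<close>.  The Jordan form exists over the reals for nilpotent \<open>X\<close> and is unique up to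
  the order of the blocks.
\<close>

definition jordan_partition :: "real ^ 'm ^ 'm \<Rightarrow> nat multiset" where
  "jordan_partition X = (THE d. \<exists>n_as. jordan_nf (to_mat X) n_as \<and> d = mset (map fst n_as))"

definition even_parts :: "real ^ 'm ^ 'm \<Rightarrow> nat set" where
  "even_parts X = {\<eta>. \<eta> \<in># jordan_partition X \<and> even \<eta>}"

definition lie_bracket :: "real ^ 'm ^ 'm \<Rightarrow> real ^ 'm ^ 'm \<Rightarrow> real ^ 'm ^ 'm" where
  "lie_bracket A B = A ** B - B ** A"

definition sl2_triple_in ::
    "(real ^ 'm ^ 'm) set \<Rightarrow> real ^ 'm ^ 'm \<Rightarrow> real ^ 'm ^ 'm \<Rightarrow> real ^ 'm ^ 'm \<Rightarrow> bool" where
  "sl2_triple_in L X H Y \<longleftrightarrow> X \<in> L \<and> H \<in> L \<and> Y \<in> L \<and> X \<noteq> 0 \<and>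
     lie_bracket H X = 2 *\<^sub>R X \<and> lie_bracket H Y = - 2 *\<^sub>R Y \<and> lie_bracket X Y = H"

definition submodule_of :: "(real ^ 'm ^ 'm) set \<Rightarrow> (real ^ 'm) set \<Rightarrow> bool" where
  "submodule_of A W \<longleftrightarrow> Real_Vector_Spaces.subspace W \<and> (\<forall>Z\<in>A. \<forall>w\<in>W. Z *v w \<in> W)"

definition irreducible_submodule :: "(real ^ 'm ^ 'm) set \<Rightarrow> (real ^ 'm) set \<Rightarrow> bool" where
  "irreducible_submodule A W \<longleftrightarrow> submodule_of A W \<and> W \<noteq> {0} \<and>
     (\<forall>U. submodule_of A U \<and> U \<subseteq> W \<longrightarrow> U = {0} \<or> U = W)"

text \<open>
  \<open>isotypic X H Y d\<close> is the space \<open>M(d - 1)\<close> and \<open>lowest X H Y d\<close> is \<open>L(d - 1)\<close>: both are indexed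
  by the dimension \<open>d\<close> of the irreducible modules.  A sum of subspaces is the span of their union.
\<close>

definition isotypic ::
    "real ^ 'm ^ 'm \<Rightarrow> real ^ 'm ^ 'm \<Rightarrow> real ^ 'm ^ 'm \<Rightarrow> nat \<Rightarrow> (real ^ 'm) set" where
  "isotypic X H Y d = Real_Vector_Spaces.span
     (\<Union>{W. irreducible_submodule (Real_Vector_Spaces.span {X, H, Y}) W \<and>
            Real_Vector_Spaces.dim W = d})"

definition lowest ::
    "real ^ 'm ^ 'm \<Rightarrow> real ^ 'm ^ 'm \<Rightarrow> real ^ 'm ^ 'm \<Rightarrow> nat \<Rightarrow> (real ^ 'm) set" where
  "lowest X H Y d = {v. Y *v v = 0} \<inter> isotypic X H Y d"

definition twisted_form ::
    "real ^ ('n::finite + 'n) ^ ('n + 'n) \<Rightarrow> nat \<Rightarrow>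
     real ^ ('n + 'n) \<Rightarrow> real ^ ('n + 'n) \<Rightarrow> real" where
  "twisted_form X d v w = symp_form v ((((*v) X) ^^ (d - 1)) w)"

definition adapted_basis ::
    "real ^ ('n::finite + 'n) ^ ('n + 'n) \<Rightarrow> real ^ ('n + 'n) ^ ('n + 'n) \<Rightarrow>
     real ^ ('n + 'n) ^ ('n + 'n) \<Rightarrow> nat \<Rightarrow> (real ^ ('n + 'n)) set \<Rightarrow> bool" where
  "adapted_basis X H Y \<eta> B \<longleftrightarrow>
     Real_Vector_Spaces.independent B \<and> Real_Vector_Spaces.span B = lowest X H Y \<eta> \<and>
     (\<forall>v\<in>B. \<forall>w\<in>B. v \<noteq> w \<longrightarrow> twisted_form X \<eta> v w = 0) \<and>
     (\<forall>v\<in>B. twisted_form X \<eta> v v = 1 \<or> twisted_form X \<eta> v v = - 1)"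

text \<open>
  The numbers \<open>p\<^sub>\<eta>\<close> and \<open>q\<^sub>\<eta>\<close> of entries \<open>+1\<close> and \<open>-1\<close> in the first column of the block of size
  \<open>t\<^sub>\<eta> \<times> \<eta>\<close> of the signed Young diagram of \<open>X\<close>, for an even part \<open>\<eta>\<close>.  An even part forces
  \<open>X \<noteq> 0\<close>, so a triple exists, and the count does not depend on the triple or on the basis.
\<close>

definition p_sign :: "real ^ ('n::finite + 'n) ^ ('n + 'n) \<Rightarrow> nat \<Rightarrow> nat" where
  "p_sign X \<eta> = (THE p. \<exists>H Y B. sl2_triple_in sp X H Y \<and> adapted_basis X H Y \<eta> B \<and>
                          p = card {v \<in> B. twisted_form X \<eta> v v = 1})"

definition q_sign :: "real ^ ('n::finite + 'n) ^ ('n + 'n) \<Rightarrow> nat \<Rightarrow> nat" where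
  "q_sign X \<eta> = count (jordan_partition X) \<eta> - p_sign X \<eta>"

end

(*
  Let om be the symplectic form.  The nilpotent X has a normal form: a basis of chains v, X v, ...,
  X^(d-1) v in which every chain is om-paired with exactly one chain (with itself if d is even), the
  pairing of the ends being 1 or -1.  The chains carry an explicit sl2-triple whose lowest weight
  vectors are the v's, so p and q count the chains of sign 1 and -1.

  If g in Sp conjugates X to -X, then for even d it changes the sign of the form (v, X^(d-1) w) on
  ker X^d.  Modulo the radical this form lives on the lowest weight vectors of any triple, so its
  signature is (p, q), and hence p = q.  Conversely, if p = q for all even d, exchange the positive
  with the negative chains of each even length: X^i v_a goes to (-1)^i X^i v_(pi a).  This is an
  isometric involution anticommuting with X.  Its determinant is 1, because J times it is
  skew-symmetric and the determinant of a skew-symmetric real matrix is not negative.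
*)
theory Submission
  imports "Jordan_Normal_Form.Jordan_Normal_Form_Uniqueness" Defs
begin

hide_const (open) VectorSpace.subspace
hide_fact (open) VectorSpace.subspace_def

section \<open>Chains of a nilpotent map that is skew for an alternating form\<close>

text \<open>The signs are read off an arbitrary sl2-triple, whereas an element \<open>g\<close>
  conjugating \<open>X\<close> to \<open>-X\<close> need not respect any triple. What
  \<open>g\<close> does respect is the kernel of \<open>X^d\<close> with its top form, since both
  are defined from \<open>X\<close> alone; this is why the signature is computed there and only then
  compared with lowest weight vectors. A triple enters the definition through irreducible submodules
  of prescribed dimension, which are hard to handle directly. The Casimir operator acts on such a
  module of dimension d by the scalar d^2 - 1, and this turns membership in \<open>lowest\<close>
  into the two equations \<open>Y v = 0\<close> and \<open>H v = (1 - d) v\<close>. Chains of odd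
  length carry no invariant sign because their top form is alternating: they occur in pairs, and the
  involution keeps each of them in place, with the factor (-1)^i on the i-th vector. Chains of even
  length have a symmetric top form, and there the sign can only be repaired by moving to a chain of
  the opposite sign.\<close>

lemma linear_funpow: "linear (f :: 'a::real_vector \<Rightarrow> 'a) \<Longrightarrow> linear (f ^^ k)"
proof (induction k)
  case 0
  then show ?case by (simp add: linear_ident)
next
  case (Suc k)
  then show ?case using linear_compose[of "f ^^ k" f] by (simp add: comp_def)
qed

text \<open>Nondegeneracy is a property of the invariant subspace under consideration, which shrinks
  during the construction of chains; it is therefore stated for that subspace.\<close>

locale symplectic_map =
  fixes om :: "'a::euclidean_space \<Rightarrow> 'a \<Rightarrow> real" and X :: "'a \<Rightarrow> 'a"
  assumes bilinear_om: "bilinear om"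
    and om_swap: "om x y = - om y x"
    and linear_X: "linear X"
    and om_X: "om (X x) y = - om x (X y)"
begin

lemmas om_simps = bilinear_ladd[OF bilinear_om] bilinear_radd[OF bilinear_om]
  bilinear_lmul[OF bilinear_om] bilinear_rmul[OF bilinear_om]
  bilinear_lzero[OF bilinear_om] bilinear_rzero[OF bilinear_om]
  bilinear_lneg[OF bilinear_om] bilinear_rneg[OF bilinear_om]
  bilinear_lsub[OF bilinear_om] bilinear_rsub[OF bilinear_om]

lemma om_sum_left: "om (\<Sum>a\<in>A. f a) y = (\<Sum>a\<in>A. om (f a) y)"
  using bilinear_om linear_sum[of "\<lambda>x. om x y" f A] by (simp add: bilinear_def)

lemma om_sum_right: "om x (\<Sum>a\<in>A. f a) = (\<Sum>a\<in>A. om x (f a))"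
  using bilinear_om by (simp add: bilinear_def linear_sum)

lemma linear_pow: "linear (X ^^ k)"
  by (rule linear_funpow[OF linear_X])

lemmas pow_simps = linear_add[OF linear_pow] linear_scale[OF linear_pow]
  linear_diff[OF linear_pow] linear_neg[OF linear_pow] linear_0[OF linear_pow]
  linear_sum[OF linear_pow]

lemma om_pow: "om ((X ^^ k) x) y = (-1) ^ k * om x ((X ^^ k) y)"
proof (induction k arbitrary: x)
  case (Suc k)
  have "om ((X ^^ Suc k) x) y = (-1) ^ k * om (X x) ((X ^^ k) y)"
    using Suc.IH[of "X x"] by (simp add: funpow_swap1)
  then show ?case by (simp add: om_X)
qed simp

text \<open>One sign comes from exchanging the arguments and k signs from moving \<open>X\<close>
  across. With k = d - 1 the form is symmetric for even d and alternating for odd d, the dichotomy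
  behind the whole classification.\<close>

lemma om_pow_swap: "om x ((X ^^ k) y) = (-1) ^ Suc k * om y ((X ^^ k) x)"
proof -
  have "om x ((X ^^ k) y) = - om ((X ^^ k) y) x" by (rule om_swap)
  then show ?thesis by (simp add: om_pow)
qed

lemma pow_in: "X ` U \<subseteq> U \<Longrightarrow> x \<in> U \<Longrightarrow> (X ^^ k) x \<in> U"
  by (induction k) auto

lemma pow_zero_mono: "(X ^^ m) x = 0 \<Longrightarrow> m \<le> k \<Longrightarrow> (X ^^ k) x = 0"
proof -
  assume "(X ^^ m) x = 0" and "m \<le> k"
  then have "(X ^^ k) x = (X ^^ (k - m)) ((X ^^ m) x)"
    using funpow_add[of "k - m" m X] by simp
  then show ?thesis using \<open>(X ^^ m) x = 0\<close> by (simp add: pow_simps)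
qed

text \<open>
  Downward induction on \<open>k\<close>: once the pairings are right for all exponents above \<open>k\<close>, adding
  \<open>X\<^sup>s t b\<close> with \<open>s = m - 1 - k\<close> to \<open>w b\<close> corrects those for \<open>k\<close> and changes none above.
\<close>

lemma orthogonalise_family:
  fixes v :: "nat \<Rightarrow> 'a"
  assumes "finite F" and U: "subspace U" "X ` U \<subseteq> U" and nil: "\<And>x. x \<in> U \<Longrightarrow> (X ^^ m) x = 0"
    and m: "m \<ge> 1" and vU: "\<And>a. a \<in> F \<Longrightarrow> v a \<in> U"
    and st: "\<And>a. a \<in> F \<Longrightarrow> st a \<in> F" "\<And>a. a \<in> F \<Longrightarrow> st (st a) = a"
    and eps: "\<And>a. a \<in> F \<Longrightarrow> eps a * eps a = (1::real)"
    and base: "\<And>a b. a \<in> F \<Longrightarrow> b \<in> F \<Longrightarrow>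
      om (v a) ((X ^^ (m - 1)) (v b)) = (if b = st a then eps a else 0)"
  shows "\<exists>w. (\<forall>a\<in>F. w a \<in> U) \<and> (\<forall>a\<in>F. \<forall>b\<in>F. \<forall>k.
      om (w a) ((X ^^ k) (w b)) = (if b = st a \<and> k + 1 = m then eps a else 0))"
proof -
  have "n \<le> m - 1 \<Longrightarrow> \<exists>w. (\<forall>a\<in>F. w a \<in> U) \<and> (\<forall>a\<in>F. \<forall>b\<in>F. \<forall>k. m - 1 \<le> k + n \<longrightarrow>
      om (w a) ((X ^^ k) (w b)) = (if b = st a \<and> k + 1 = m then eps a else 0))" for n
  proof (induction n)
    case 0
    have "om (v a) ((X ^^ k) (v b)) = (if b = st a \<and> k + 1 = m then eps a else 0)"
      if "a \<in> F" "b \<in> F" "m - 1 \<le> k" for a b k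
    proof (cases "k = m - 1")
      case True
      then show ?thesis using base[OF that(1,2)] m by auto
    next
      case False
      with that(3) m have "m \<le> k" by linarith
      then have "(X ^^ k) (v b) = 0" using pow_zero_mono nil vU that(2) by blast
      then show ?thesis using \<open>m \<le> k\<close> by (simp add: om_simps)
    qed
    then show ?case using vU by (intro exI[of _ v]) auto
  next
    case (Suc n)
    then obtain w where wU: "\<And>a. a \<in> F \<Longrightarrow> w a \<in> U"
      and w: "\<And>a b k. a \<in> F \<Longrightarrow> b \<in> F \<Longrightarrow> m - 1 \<le> k + n \<Longrightarrow>
        om (w a) ((X ^^ k) (w b)) = (if b = st a \<and> k + 1 = m then eps a else 0)"
      by (metis Suc_leD)
    define s where "s = Suc n"
    define k0 where "k0 = m - 1 - s"
    have sk: "s + k0 = m - 1" "k0 + 1 < m" using Suc.prems by (auto simp: s_def k0_def)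
    define g where "g a b = om (w a) ((X ^^ k0) (w b))" for a b
    \<comment> \<open>At the top exponent \<open>w a\<close> sees only \<open>w (st a)\<close>, with
      value \<open>eps a\<close>, so these coefficients prescribe the pairings of \<open>w a\<close>
      with \<open>X^(m-1) (t b)\<close> as \<open>- g a b / 2\<close>. Half suffices because the
      correction enters through both arguments and the two contributions agree by symmetry.\<close>
    define t where "t b = (\<Sum>c\<in>F. (- (g c b / 2 * eps c)) *\<^sub>R w (st c))" for b
    define w' where "w' b = w b + (X ^^ s) (t b)" for b
    have tU: "t b \<in> U" for b
      unfolding t_def using U(1) wU st(1) by (intro subspace_sum subspace_scale) auto
    have w'U: "w' a \<in> U" if "a \<in> F" for a
      unfolding w'_def using U wU[OF that] tU pow_in[of U] by (intro subspace_add) auto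
    have gs: "g b a = (-1) ^ Suc k0 * g a b" for a b
      unfolding g_def by (rule om_pow_swap)
    have ot: "om (w a) ((X ^^ (m - 1)) (t b)) = - g a b / 2" if a: "a \<in> F" for a b
    proof -
      have "om (w a) ((X ^^ (m - 1)) (t b)) =
          (\<Sum>c\<in>F. - (g c b / 2 * eps c) * om (w a) ((X ^^ (m - 1)) (w (st c))))"
        unfolding t_def by (simp add: pow_simps om_sum_right om_simps)
      also have "\<dots> = (\<Sum>c\<in>F. if c = a then - g a b / 2 else 0)"
      proof (rule sum.cong[OF refl])
        fix c assume c: "c \<in> F"
        have "st c = st a \<longleftrightarrow> c = a" using st(2)[OF a] st(2)[OF c] by metis
        then show "- (g c b / 2 * eps c) * om (w a) ((X ^^ (m - 1)) (w (st c))) =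
            (if c = a then - g a b / 2 else 0)"
          using w[OF a st(1)[OF c], of "m - 1"] eps[OF a] m by (auto simp: mult.assoc)
      qed
      also have "\<dots> = - g a b / 2" using a \<open>finite F\<close> by simp
      finally show ?thesis .
    qed
    have "om (w' a) ((X ^^ k) (w' b)) = (if b = st a \<and> k + 1 = m then eps a else 0)"
      if a: "a \<in> F" and b: "b \<in> F" and k: "m - 1 \<le> k + Suc n" for a b k
    proof -
      have sgn: "(-1::real) ^ s * (-1) ^ Suc (s + k) = (-1) ^ Suc k"
        by (simp add: power_add mult.assoc[symmetric] flip: power_mult_distrib)
      \<comment> \<open>The term quadratic in the correction carries the exponent k + 2 s; as k + s
        >= m - 1 and s >= 1, it vanishes by nilpotency.\<close>
      have "m \<le> s + (k + s)" using k by (simp add: s_def)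
      then have z: "(X ^^ (s + (k + s))) (t b) = 0" by (rule pow_zero_mono[OF nil[OF tU]])
      have "om (w' a) ((X ^^ k) (w' b)) = om (w a) ((X ^^ k) (w b)) +
          om (w a) ((X ^^ (k + s)) (t b)) + (-1) ^ s * om (t a) ((X ^^ (s + k)) (w b)) +
          (-1) ^ s * om (t a) ((X ^^ (s + (k + s))) (t b))"
        unfolding w'_def by (simp add: pow_simps om_simps om_pow funpow_add)
      also have "\<dots> = om (w a) ((X ^^ k) (w b)) + om (w a) ((X ^^ (s + k)) (t b)) +
          (-1) ^ Suc k * om (w b) ((X ^^ (s + k)) (t a))"
        unfolding z using om_pow_swap[of "t a" "s + k" "w b"] sgn
        by (simp add: om_simps add.commute mult.assoc[symmetric])
      finally have e: "om (w' a) ((X ^^ k) (w' b)) = om (w a) ((X ^^ k) (w b)) +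
          om (w a) ((X ^^ (s + k)) (t b)) + (-1) ^ Suc k * om (w b) ((X ^^ (s + k)) (t a))" .
      show ?thesis
      proof (cases "k = k0")
        case True
        have sq: "(-1::real) ^ k0 * (-1) ^ k0 = 1" by (simp flip: power_mult_distrib)
        have "om (w' a) ((X ^^ k) (w' b)) = g a b - g a b / 2 + (-1) ^ Suc k0 * (- g b a / 2)"
          unfolding e using ot[OF a] ot[OF b] sk True by (simp add: g_def)
        also have "\<dots> = 0" using gs[of b a] sq by (simp add: mult.assoc[symmetric])
        finally show ?thesis using True sk by simp
      next
        case False
        then have k': "m - 1 \<le> k + n" "m \<le> s + k" using k sk by (auto simp: s_def)
        then have "(X ^^ (s + k)) (t b) = 0" for b using pow_zero_mono[OF nil[OF tU]] by blast
        then show ?thesis unfolding e using w[OF a b k'(1)] by (simp add: om_simps)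
      qed
    qed
    then show ?case using w'U by (intro exI[of _ w']) auto
  qed
  from this[of "m - 1"] show ?thesis by simp
qed

text \<open>Pairing with the complementary vector of the partner chain is the dual basis up to sign;
  the factor \<open>(-1) ^ i * eps a\<close> cancels the sign of the pairing of
  \<open>X^i (v a)\<close> with it.\<close>

definition chain_coord :: "(nat \<Rightarrow> 'a) \<Rightarrow> (nat \<Rightarrow> nat) \<Rightarrow> (nat \<Rightarrow> real) \<Rightarrow> (nat \<Rightarrow> nat) \<Rightarrow>
    nat \<Rightarrow> nat \<Rightarrow> 'a \<Rightarrow> real" where
  "chain_coord v d eps st a i y = (-1) ^ i * eps a * om y ((X ^^ (d a - 1 - i)) (v (st a)))"

text \<open>
  A normal form of \<open>X\<close> on \<open>U\<close>: the vectors \<open>X\<^sup>i (v a)\<close> with \<open>i < d a\<close> form a basis of \<open>U\<close>, the chain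
  of \<open>a\<close> is paired with that of \<open>st a\<close> only, and \<open>chain_coord\<close> gives the coordinates in this basis.
\<close>

definition chain_family :: "'a set \<Rightarrow> nat set \<Rightarrow> (nat \<Rightarrow> 'a) \<Rightarrow> (nat \<Rightarrow> nat) \<Rightarrow> (nat \<Rightarrow> real) \<Rightarrow>
    (nat \<Rightarrow> nat) \<Rightarrow> bool" where
  "chain_family U I v d eps st \<longleftrightarrow> finite I \<and>
    (\<forall>a\<in>I. v a \<in> U \<and> 1 \<le> d a \<and> st a \<in> I \<and> st (st a) = a \<and> d (st a) = d a \<and>
      (eps a = 1 \<or> eps a = - 1) \<and> (even (d a) \<longrightarrow> st a = a) \<and> (X ^^ d a) (v a) = 0) \<and>
    (\<forall>a\<in>I. \<forall>b\<in>I. \<forall>k. om (v a) ((X ^^ k) (v b)) = (if b = st a \<and> k + 1 = d a then eps a else 0)) \<and>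
    (\<forall>y\<in>U. y = (\<Sum>a\<in>I. \<Sum>i<d a. chain_coord v d eps st a i y *\<^sub>R (X ^^ i) (v a)))"

text \<open>Nondegeneracy makes the form with top exponent m - 1 nonzero on \<open>U\<close>. If m
  is even it is symmetric, polarisation yields a vector with nonzero square, and scaling leaves only
  a sign. If m is odd it is alternating, so the smallest normalised piece is a hyperbolic pair.
  \<open>N\<close> supplies one or two fresh chain labels.\<close>

lemma top_pairing:
  assumes nd: "\<And>x. x \<in> U \<Longrightarrow> (\<And>y. y \<in> U \<Longrightarrow> om x y = 0) \<Longrightarrow> x = 0"
    and U: "subspace U" "X ` U \<subseteq> U" and m: "m \<ge> 1" and w: "w \<in> U" "(X ^^ (m - 1)) w \<noteq> 0"
  obtains F and v :: "nat \<Rightarrow> 'a" and st :: "nat \<Rightarrow> nat" and eps :: "nat \<Rightarrow> real"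
  where "F \<noteq> {}" "F \<subseteq> {N, Suc N}" "\<And>a. a \<in> F \<Longrightarrow> v a \<in> U" "\<And>a. a \<in> F \<Longrightarrow> st a \<in> F"
    "\<And>a. a \<in> F \<Longrightarrow> st (st a) = a" "\<And>a. a \<in> F \<Longrightarrow> eps a = 1 \<or> eps a = -1"
    "even m \<Longrightarrow> (\<And>a. a \<in> F \<Longrightarrow> st a = a)"
    "\<And>a b. a \<in> F \<Longrightarrow> b \<in> F \<Longrightarrow>
      om (v a) ((X ^^ (m - 1)) (v b)) = (if b = st a then eps a else 0)"
proof -
  define \<beta> where "\<beta> x y = om x ((X ^^ (m - 1)) y)" for x y
  have sw: "\<beta> x y = (-1) ^ m * \<beta> y x" for x y
    unfolding \<beta>_def using om_pow_swap[of x "m - 1" y] m by simp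
  have \<beta>_simps: "\<beta> (x + y) z = \<beta> x z + \<beta> y z" "\<beta> x (y + z) = \<beta> x y + \<beta> x z"
    "\<beta> (c *\<^sub>R x) y = c * \<beta> x y" "\<beta> x (c *\<^sub>R y) = c * \<beta> x y" for x y z c
    unfolding \<beta>_def by (simp_all add: pow_simps om_simps)
  have "\<exists>u\<in>U. om ((X ^^ (m - 1)) w) u \<noteq> 0"
    using nd[OF pow_in[OF U(2) w(1)]] w(2) by blast
  then obtain u where u: "u \<in> U" "\<beta> u w \<noteq> 0"
    unfolding \<beta>_def using om_swap by (metis neg_0_equal_iff_equal)
  show thesis
  proof (cases "even m")
    case True
    have "\<exists>x\<in>U. \<beta> x x \<noteq> 0"
    proof (rule ccontr)
      assume "\<not> ?thesis"
      then have z: "\<beta> x x = 0" if "x \<in> U" for x using that by blast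
      have "\<beta> (u + w) (u + w) = 0" using z subspace_add[OF U(1) u(1) w(1)] by blast
      then show False using z[OF u(1)] z[OF w(1)] sw[of w u] u(2) True by (simp add: \<beta>_simps)
    qed
    then obtain x where x: "x \<in> U" "\<beta> x x \<noteq> 0" by blast
    define y where "y = (1 / sqrt \<bar>\<beta> x x\<bar>) *\<^sub>R x"
    have "sqrt \<bar>\<beta> x x\<bar> * sqrt \<bar>\<beta> x x\<bar> = \<bar>\<beta> x x\<bar>" by simp
    then have "\<beta> y y = \<beta> x x / \<bar>\<beta> x x\<bar>"
      unfolding y_def \<beta>_simps by (metis divide_divide_eq_left' mult.commute times_divide_eq_right mult.right_neutral)
    then have y: "\<beta> y y = 1 \<or> \<beta> y y = -1" using x(2) by (cases "\<beta> x x > 0") auto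
    have "y \<in> U" unfolding y_def using U(1) x(1) by (simp add: subspace_scale)
    then show thesis
      using that[of "{N}" "\<lambda>_. y" "\<lambda>a. a" "\<lambda>_. \<beta> y y"] y by (auto simp: \<beta>_def)
  next
    case False
    have sk: "\<beta> x y = - \<beta> y x" for x y using sw[of x y] False by simp
    then have z: "\<beta> x x = 0" for x by (metis eq_neg_iff_add_eq_0 mult_2 mult_eq_0_iff zero_neq_numeral)
    define y where "y = (1 / \<beta> u w) *\<^sub>R w"
    have y: "\<beta> u y = 1" "\<beta> y u = -1" using u(2) sk[of w u] by (auto simp: y_def \<beta>_simps)
    have yU: "y \<in> U" unfolding y_def using U(1) w(1) by (simp add: subspace_scale)
    show thesis
      by (rule that[of "{N, Suc N}" "\<lambda>a. if a = N then u else y"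
            "\<lambda>a. if a = N then Suc N else N" "\<lambda>a. if a = N then 1 else - 1"])
        (use u(1) yU False y[unfolded \<beta>_def] z[unfolded \<beta>_def] in \<open>auto split: if_splits\<close>)
  qed
qed

text \<open>On the span of the given chains \<open>om\<close> is nondegenerate, so \<open>U\<close>
  is the sum of that span and its orthogonal complement \<open>U'\<close>. Skewness of
  \<open>X\<close> makes \<open>U'\<close> invariant, and it is strictly smaller because no
  \<open>v a\<close> is orthogonal to its partner chain. Labels from N + 2 on keep the chains found
  in \<open>U'\<close> apart from those in \<open>F\<close>.\<close>

lemma split_off_chains:
  assumes nd: "\<And>x. x \<in> U \<Longrightarrow> (\<And>y. y \<in> U \<Longrightarrow> om x y = 0) \<Longrightarrow> x = 0"
    and U: "subspace U" "X ` U \<subseteq> U" and nil: "\<And>x. x \<in> U \<Longrightarrow> (X ^^ m) x = 0"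
    and m: "m \<ge> 1" and F: "F \<noteq> {}" "F \<subseteq> {N, Suc N}" and vU: "\<And>a. a \<in> F \<Longrightarrow> v a \<in> U"
    and st: "\<And>a. a \<in> F \<Longrightarrow> st a \<in> F" "\<And>a. a \<in> F \<Longrightarrow> st (st a) = a"
    and eps: "\<And>a. a \<in> F \<Longrightarrow> eps a = 1 \<or> eps a = -(1::real)"
    and ev: "even m \<Longrightarrow> (\<And>a. a \<in> F \<Longrightarrow> st a = a)"
    and v: "\<And>a b k. a \<in> F \<Longrightarrow> b \<in> F \<Longrightarrow>
      om (v a) ((X ^^ k) (v b)) = (if b = st a \<and> k + 1 = m then eps a else 0)"
    and IH: "\<And>U'. subspace U' \<Longrightarrow> X ` U' \<subseteq> U' \<Longrightarrow>
      (\<And>x. x \<in> U' \<Longrightarrow> (\<And>y. y \<in> U' \<Longrightarrow> om x y = 0) \<Longrightarrow> x = 0) \<Longrightarrow> dim U' < dim U \<Longrightarrow>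
      \<exists>I v d eps st. chain_family U' I v d eps st \<and> I \<subseteq> {N + 2..}"
  shows "\<exists>I v d eps st. chain_family U I v d eps st \<and> I \<subseteq> {N..}"
proof -
  have finF: "finite F" using F(2) finite_subset by blast
  have eps2: "eps a * eps a = 1" if "a \<in> F" for a using eps[OF that] by auto
  define c where "c a i y = chain_coord v (\<lambda>_. m) eps st a i y" for a i y
  \<comment> \<open>The orthogonal projection onto the span of the new chains: \<open>P y\<close>
    has the same pairings with them as \<open>y\<close>.\<close>
  define P where "P y = (\<Sum>a\<in>F. \<Sum>i<m. c a i y *\<^sub>R (X ^^ i) (v a))" for y
  define U' where "U' = {y \<in> U. \<forall>a\<in>F. \<forall>i. om y ((X ^^ i) (v a)) = 0}"
  have PU: "P y \<in> U" for y
    unfolding P_def using U vU pow_in[OF U(2)] by (intro subspace_sum subspace_scale) auto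
  have Pom: "om (P y) ((X ^^ j) (v b)) = om y ((X ^^ j) (v b))" if y: "y \<in> U" and b: "b \<in> F" for y b j
  proof (cases "j < m")
    case False
    then have "(X ^^ j) (v b) = 0" using pow_zero_mono[OF nil[OF vU[OF b]]] by simp
    then show ?thesis by (simp add: om_simps)
  next
    case True
    have "om (P y) ((X ^^ j) (v b)) =
        (\<Sum>a\<in>F. \<Sum>i<m. if a = st b then (if i = m - 1 - j then om y ((X ^^ j) (v b)) else 0) else 0)"
      unfolding P_def om_sum_left
    proof (intro sum.cong refl)
      fix a i assume a: "a \<in> F" and i: "i \<in> {..<m}"
      have e: "om ((X ^^ i) (v a)) ((X ^^ j) (v b)) =
          (-1) ^ i * (if b = st a \<and> i + j + 1 = m then eps a else 0)"
        using v[OF a b, of "i + j"] by (simp add: om_pow funpow_add)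
      have "b = st a \<longleftrightarrow> a = st b" using st(2)[OF a] st(2)[OF b] by metis
      moreover have "i + j + 1 = m \<longleftrightarrow> i = m - 1 - j" using True i by auto
      moreover have "m - 1 - (m - 1 - j) = j" using True by auto
      moreover have "(-1::real) ^ i * (-1) ^ i = 1" by (simp flip: power_mult_distrib)
      ultimately show "om (c a i y *\<^sub>R (X ^^ i) (v a)) ((X ^^ j) (v b)) =
          (if a = st b then (if i = m - 1 - j then om y ((X ^^ j) (v b)) else 0) else 0)"
        using eps2[OF a] st(2)[OF b]
        by (auto simp: om_simps e c_def chain_coord_def mult.left_commute mult.assoc)
    qed
    also have "\<dots> = (\<Sum>a\<in>F. if a = st b then om y ((X ^^ j) (v b)) else 0)"
      using True by (intro sum.cong) auto
    also have "\<dots> = om y ((X ^^ j) (v b))"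
      using finF st(1)[OF b] by simp
    finally show ?thesis .
  qed
  have U'U: "U' \<subseteq> U" by (auto simp: U'_def)
  have U's: "subspace U'"
    using U(1) unfolding U'_def subspace_def by (auto simp: om_simps)
  have U'X: "X ` U' \<subseteq> U'"
  proof -
    have "om (X y) ((X ^^ i) (v a)) = 0" if "y \<in> U'" "a \<in> F" for y a i
    proof -
      have "om y ((X ^^ Suc i) (v a)) = 0" using that unfolding U'_def by blast
      then show ?thesis using om_X[of y "(X ^^ i) (v a)"] by simp
    qed
    then show ?thesis using U(2) U'U unfolding U'_def by auto
  qed
  have dec: "y - P y \<in> U'" if "y \<in> U" for y
    unfolding U'_def using subspace_diff[OF U(1) that PU] Pom[OF that] by (auto simp: om_simps)
  have U'P: "om x (P y) = 0" if "x \<in> U'" for x y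
    unfolding P_def om_sum_right using that by (auto simp: om_simps U'_def)
  have nd': "x = 0" if x: "x \<in> U'" and o: "\<And>y. y \<in> U' \<Longrightarrow> om x y = 0" for x
  proof (rule nd)
    show "x \<in> U" using x U'U by blast
    fix y assume "y \<in> U"
    then have "om x ((y - P y) + P y) = 0"
      using o[OF dec] U'P[OF x] by (simp only: om_simps)
    then show "om x y = 0" by simp
  qed
  have "dim U' < dim U"
  proof -
    obtain a where a: "a \<in> F" using F(1) by blast
    have "om (v a) ((X ^^ (m - 1)) (v (st a))) \<noteq> 0"
      using v[OF a st(1)[OF a], of "m - 1"] m eps[OF a] by auto
    then have "v a \<notin> U'" using st(1)[OF a] unfolding U'_def by blast
    then have "U' \<subset> U" using vU[OF a] U'U by blast
    then show ?thesis using U's U(1) by (intro dim_psubset) (simp add: span_eq_iff[THEN iffD2])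
  qed
  from IH[OF U's U'X nd' this]
  obtain I' v' d' eps' st' where cf: "chain_family U' I' v' d' eps' st'" and I': "I' \<subseteq> {N + 2..}"
    by blast
  have disj: "a \<notin> I'" if "a \<in> F" for a using that F(2) I' by force
  have disj': "a \<notin> F" if "a \<in> I'" for a using that disj by blast
  define V where "V a = (if a \<in> F then v a else v' a)" for a
  define D where "D a = (if a \<in> F then m else d' a)" for a
  define E where "E a = (if a \<in> F then eps a else eps' a)" for a
  define S where "S a = (if a \<in> F then st a else st' a)" for a
  have cfp: "finite I'" "\<And>a. a \<in> I' \<Longrightarrow> v' a \<in> U' \<and> 1 \<le> d' a \<and> st' a \<in> I' \<and> st' (st' a) = a \<and>
      d' (st' a) = d' a \<and> (eps' a = 1 \<or> eps' a = - 1) \<and> (even (d' a) \<longrightarrow> st' a = a) \<and>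
      (X ^^ d' a) (v' a) = 0"
    "\<And>a b k. a \<in> I' \<Longrightarrow> b \<in> I' \<Longrightarrow>
      om (v' a) ((X ^^ k) (v' b)) = (if b = st' a \<and> k + 1 = d' a then eps' a else 0)"
    "\<And>y. y \<in> U' \<Longrightarrow> y = (\<Sum>a\<in>I'. \<Sum>i<d' a. chain_coord v' d' eps' st' a i y *\<^sub>R (X ^^ i) (v' a))"
    using cf unfolding chain_family_def by blast+
  have "chain_family U (F \<union> I') V D E S"
    unfolding chain_family_def
  proof (intro conjI ballI allI)
    show "finite (F \<union> I')" using finF cfp(1) by simp
  next
    fix a assume a: "a \<in> F \<union> I'"
    have "V a \<in> U \<and> 1 \<le> D a \<and> S a \<in> F \<union> I' \<and> S (S a) = a \<and> D (S a) = D a \<and>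
        (E a = 1 \<or> E a = - 1) \<and> (even (D a) \<longrightarrow> S a = a) \<and> (X ^^ D a) (V a) = 0"
    proof (cases "a \<in> F")
      case True
      then show ?thesis
        using vU st eps ev nil m by (auto simp: V_def D_def E_def S_def)
    next
      case False
      with a have a': "a \<in> I'" by blast
      with cfp(2)[OF a'] have "st' a \<notin> F" using disj' by blast
      then show ?thesis
        using False cfp(2)[OF a'] U'U by (auto simp: V_def D_def E_def S_def)
    qed
    then show "V a \<in> U" "1 \<le> D a" "S a \<in> F \<union> I'" "S (S a) = a" "D (S a) = D a"
        "E a = 1 \<or> E a = - 1" "even (D a) \<longrightarrow> S a = a" "(X ^^ D a) (V a) = 0" by blast+
  next
    fix a b k assume a: "a \<in> F \<union> I'" and b: "b \<in> F \<union> I'"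
    consider "a \<in> F" "b \<in> F" | "a \<in> I'" "b \<in> I'" | "a \<in> F" "b \<in> I'" | "a \<in> I'" "b \<in> F"
      using a b by blast
    then show "om (V a) ((X ^^ k) (V b)) = (if b = S a \<and> k + 1 = D a then E a else 0)"
    proof cases
      case 1
      then show ?thesis using v by (simp add: V_def D_def E_def S_def)
    next
      case 2
      then show ?thesis using cfp(3) disj' by (simp add: V_def D_def E_def S_def)
    next
      case 3
      then have "v' b \<in> U'" using cfp(2) by blast
      then have "om (v' b) ((X ^^ k) (v a)) = 0" using 3 by (simp add: U'_def)
      then have "om (v a) ((X ^^ k) (v' b)) = 0" by (subst om_pow_swap) simp
      moreover have "b \<noteq> st a" using 3 st(1) disj by blast
      ultimately show ?thesis using 3 disj' by (simp add: V_def D_def E_def S_def)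
    next
      case 4
      then have "v' a \<in> U'" using cfp(2) by blast
      then have "om (v' a) ((X ^^ k) (v b)) = 0" using 4 by (simp add: U'_def)
      moreover have "b \<noteq> st' a" using 4 cfp(2) disj by blast
      ultimately show ?thesis using 4 disj' by (simp add: V_def D_def E_def S_def)
    qed
  next
    fix y assume y: "y \<in> U"
    have cF: "chain_coord V D E S a i y = c a i y" if "a \<in> F" for a i
      using that st(1) by (simp add: c_def chain_coord_def V_def D_def E_def S_def)
    \<comment> \<open>The part \<open>P y\<close> is orthogonal to \<open>U'\<close>, hence
      invisible to coordinates taken along chains inside \<open>U'\<close>.\<close>
    have cI: "chain_coord V D E S a i y = chain_coord v' d' eps' st' a i (y - P y)" if a: "a \<in> I'" for a i
    proof -
      have s: "st' a \<in> I'" "v' (st' a) \<in> U'" using cfp(2) a by blast+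
      then have "om ((X ^^ k) (v' (st' a))) (P y) = 0" for k
        using U'P pow_in[OF U'X] by blast
      then have "om (P y) ((X ^^ k) (v' (st' a))) = 0" for k by (subst om_swap) simp
      then show ?thesis
        using a s disj' by (simp add: chain_coord_def V_def D_def E_def S_def om_simps)
    qed
    have "(\<Sum>a\<in>F \<union> I'. \<Sum>i<D a. chain_coord V D E S a i y *\<^sub>R (X ^^ i) (V a)) =
        (\<Sum>a\<in>F. \<Sum>i<D a. chain_coord V D E S a i y *\<^sub>R (X ^^ i) (V a)) +
        (\<Sum>a\<in>I'. \<Sum>i<D a. chain_coord V D E S a i y *\<^sub>R (X ^^ i) (V a))"
      using finF cfp(1) disj by (intro sum.union_disjoint) auto
    also have "(\<Sum>a\<in>F. \<Sum>i<D a. chain_coord V D E S a i y *\<^sub>R (X ^^ i) (V a)) = P y"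
      unfolding P_def by (intro sum.cong) (auto simp: V_def D_def cF)
    also have "(\<Sum>a\<in>I'. \<Sum>i<D a. chain_coord V D E S a i y *\<^sub>R (X ^^ i) (V a)) =
        (\<Sum>a\<in>I'. \<Sum>i<d' a. chain_coord v' d' eps' st' a i (y - P y) *\<^sub>R (X ^^ i) (v' a))"
      using disj' by (intro sum.cong) (auto simp: V_def D_def cI)
    also have "\<dots> = y - P y" using cfp(4)[OF dec[OF y]] by simp
    finally show "y = (\<Sum>a\<in>F \<union> I'. \<Sum>i<D a. chain_coord V D E S a i y *\<^sub>R (X ^^ i) (V a))" by simp
  qed
  moreover have "F \<union> I' \<subseteq> {N..}" using F(2) I' by auto
  ultimately show ?thesis by blast
qed

text \<open>Here m is the nilpotency index on \<open>U\<close>, so the longest chains are split off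
  and the dimension drops. The lower bound on the labels is carried through the induction to keep
  successive families disjoint.\<close>

lemma exists_chain_family:
  assumes "\<And>x. (X ^^ n) x = 0" and "subspace U" and "X ` U \<subseteq> U"
    and "\<And>x. x \<in> U \<Longrightarrow> (\<And>y. y \<in> U \<Longrightarrow> om x y = 0) \<Longrightarrow> x = 0"
  shows "\<exists>I v d eps st. chain_family U I v d eps st \<and> I \<subseteq> {N..}"
  using assms(2-)
proof (induction "dim U" arbitrary: U N rule: less_induct)
  case less
  note U = less.prems(1,2) and nd = less.prems(3)
  show ?case
  proof (cases "U \<subseteq> {0}")
    case True
    then show ?thesis
      by (intro exI[of _ "{}"]) (auto simp: chain_family_def)
  next
    case False
    then obtain x0 where x0: "x0 \<in> U" "x0 \<noteq> 0" by auto
    define m where "m = (LEAST m. \<forall>x\<in>U. (X ^^ m) x = 0)"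
    have nil: "(X ^^ m) x = 0" if "x \<in> U" for x
      using LeastI[of "\<lambda>m. \<forall>x\<in>U. (X ^^ m) x = 0" n] assms(1) that unfolding m_def by blast
    have m: "m \<ge> 1" using nil[OF x0(1)] x0(2) by (cases m) auto
    have "\<not> (\<forall>x\<in>U. (X ^^ (m - 1)) x = 0)"
      using not_less_Least[of "m - 1" "\<lambda>m. \<forall>x\<in>U. (X ^^ m) x = 0"] m unfolding m_def by force
    then obtain w where w: "w \<in> U" "(X ^^ (m - 1)) w \<noteq> 0" by blast
    have IH: "\<exists>I v d eps st. chain_family U' I v d eps st \<and> I \<subseteq> {N + 2..}"
      if "subspace U'" "X ` U' \<subseteq> U'" "\<And>x. x \<in> U' \<Longrightarrow> (\<And>y. y \<in> U' \<Longrightarrow> om x y = 0) \<Longrightarrow> x = 0"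
        "dim U' < dim U" for U'
      using less.hyps[OF that(4,1,2,3)] .
    show ?thesis
    proof (rule top_pairing[of U m w N, OF _ U m w])
      fix F and v0 :: "nat \<Rightarrow> 'a" and st :: "nat \<Rightarrow> nat" and eps :: "nat \<Rightarrow> real"
      assume F: "F \<noteq> {}" "F \<subseteq> {N, Suc N}" and v0: "\<And>a. a \<in> F \<Longrightarrow> v0 a \<in> U"
        and st: "\<And>a. a \<in> F \<Longrightarrow> st a \<in> F" "\<And>a. a \<in> F \<Longrightarrow> st (st a) = a"
        and eps: "\<And>a. a \<in> F \<Longrightarrow> eps a = 1 \<or> eps a = -1"
        and ev: "even m \<Longrightarrow> (\<And>a. a \<in> F \<Longrightarrow> st a = a)"
        and base: "\<And>a b. a \<in> F \<Longrightarrow> b \<in> F \<Longrightarrow>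
          om (v0 a) ((X ^^ (m - 1)) (v0 b)) = (if b = st a then eps a else 0)"
      have finF: "finite F" using F(2) finite_subset by blast
      have eps2: "eps a * eps a = 1" if "a \<in> F" for a using eps[OF that] by auto
      obtain v where "\<forall>a\<in>F. v a \<in> U" and "\<forall>a\<in>F. \<forall>b\<in>F. \<forall>k.
          om (v a) ((X ^^ k) (v b)) = (if b = st a \<and> k + 1 = m then eps a else 0)"
        using orthogonalise_family[OF finF U nil m v0 st eps2 base] by blast
      then have vU: "\<And>a. a \<in> F \<Longrightarrow> v a \<in> U" and v: "\<And>a b k. a \<in> F \<Longrightarrow> b \<in> F \<Longrightarrow>
          om (v a) ((X ^^ k) (v b)) = (if b = st a \<and> k + 1 = m then eps a else 0)"
        by blast+
      show ?thesis
        by (rule split_off_chains[OF _ U nil m F vU st eps ev v IH]) (use nd in blast)+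
    qed (use nd in blast)+
  qed
qed

end

section \<open>Lowest weight vectors of sl2-representations\<close>

locale sl2_rep =
  fixes X H Y :: "'a::euclidean_space \<Rightarrow> 'a"
  assumes linear_X: "linear X" and linear_H: "linear H" and linear_Y: "linear Y"
    and H_X: "H (X v) = X (H v) + 2 *\<^sub>R X v"
    and H_Y: "H (Y v) = Y (H v) - 2 *\<^sub>R Y v"
    and X_Y: "X (Y v) = Y (X v) + H v"
begin

lemmas X_simps = linear_add[OF linear_X] linear_scale[OF linear_X]
  linear_diff[OF linear_X] linear_neg[OF linear_X] linear_0[OF linear_X]
lemmas H_simps = linear_add[OF linear_H] linear_scale[OF linear_H]
  linear_diff[OF linear_H] linear_neg[OF linear_H] linear_0[OF linear_H]
lemmas Y_simps = linear_add[OF linear_Y] linear_scale[OF linear_Y]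
  linear_diff[OF linear_Y] linear_neg[OF linear_Y] linear_0[OF linear_Y]
lemmas pow_simps = linear_add[OF linear_funpow[OF linear_X]] linear_scale[OF linear_funpow[OF linear_X]]
  linear_diff[OF linear_funpow[OF linear_X]] linear_neg[OF linear_funpow[OF linear_X]]
  linear_0[OF linear_funpow[OF linear_X]] linear_sum[OF linear_funpow[OF linear_X]]

text \<open>The automorphism exchanging raising and lowering; it turns each result on lowest weight
  vectors into one on highest weight vectors.\<close>

lemma swap: "sl2_rep Y (\<lambda>v. - H v) X"
proof (rule sl2_rep.intro)
  show "linear (\<lambda>v. - H v)" by (rule linear_compose_neg[OF linear_H])
  show "- H (Y v) = Y (- H v) + 2 *\<^sub>R Y v" for v
    unfolding H_Y Y_simps by simp
  show "- H (X v) = X (- H v) - 2 *\<^sub>R X v" for v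
    unfolding H_X X_simps by simp
  show "Y (X v) = X (Y v) + - H v" for v
    unfolding X_Y by simp
qed (rule linear_Y linear_X)+

lemma H_pow: "H ((X ^^ k) v) = (X ^^ k) (H v) + (2 * real k) *\<^sub>R (X ^^ k) v"
  by (induction k) (simp_all add: H_X X_simps algebra_simps)

lemma Y_pow: "Y ((X ^^ Suc k) v) =
    (X ^^ Suc k) (Y v) - real (Suc k) *\<^sub>R ((X ^^ k) (H v) + real k *\<^sub>R (X ^^ k) v)"
proof (induction k)
  case 0
  then show ?case using X_Y[of v] by simp
next
  case (Suc k)
  have "Y ((X ^^ Suc (Suc k)) v) = X (Y ((X ^^ Suc k) v)) - H ((X ^^ Suc k) v)"
    using X_Y[of "(X ^^ Suc k) v"] by simp
  also have "X (Y ((X ^^ Suc k) v)) = (X ^^ Suc (Suc k)) (Y v) -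
      real (Suc k) *\<^sub>R ((X ^^ Suc k) (H v) + real k *\<^sub>R (X ^^ Suc k) v)"
    unfolding Suc by (simp add: X_simps)
  finally have e: "Y ((X ^^ Suc (Suc k)) v) = (X ^^ Suc (Suc k)) (Y v) -
      real (Suc k) *\<^sub>R ((X ^^ Suc k) (H v) + real k *\<^sub>R (X ^^ Suc k) v) -
      ((X ^^ Suc k) (H v) + (2 * real (Suc k)) *\<^sub>R (X ^^ Suc k) v)"
    unfolding H_pow .
  show ?case unfolding e
    by (rule euclidean_eqI) (simp add: inner_simps algebra_simps del: funpow.simps)
qed

lemma lowest_weight_pow:
  assumes "Y v = 0" and "H v = c *\<^sub>R v"
  shows "H ((X ^^ k) v) = (c + 2 * real k) *\<^sub>R (X ^^ k) v"
    and "Y ((X ^^ Suc k) v) = (- (real (Suc k) * (c + real k))) *\<^sub>R (X ^^ k) v"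
  unfolding H_pow Y_pow assms by (simp_all add: pow_simps X_simps algebra_simps)

text \<open>Otherwise \<open>H\<close> would have infinitely many eigenvalues \<open>c + 2 k\<close>; a bound on its norm excludes this.\<close>

lemma lowest_weight_pos_zero:
  assumes Y: "Y v = 0" and H: "H v = c *\<^sub>R v" and c: "c > 0"
  shows "v = 0"
proof (rule ccontr)
  assume v: "v \<noteq> 0"
  have nz: "(X ^^ k) v \<noteq> 0" for k
  proof (induction k)
    case (Suc k)
    have "real (Suc k) * (c + real k) > 0" using c by (intro mult_pos_pos) auto
    then have "- (real (Suc k) * (c + real k)) \<noteq> 0" by linarith
    then have "Y ((X ^^ Suc k) v) \<noteq> 0" unfolding lowest_weight_pow(2)[OF Y H] scaleR_eq_0_iff using Suc by blast
    then show ?case by (intro notI) (simp add: Y_simps)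
  qed (use v in simp)
  obtain B where "\<forall>x. norm (H x) \<le> B * norm x" using linear_bounded[OF linear_H] ..
  then have B: "norm (H x) \<le> B * norm x" for x ..
  obtain k where k: "B < real k" using reals_Archimedean2 by blast
  have "(c + 2 * real k) * norm ((X ^^ k) v) \<le> B * norm ((X ^^ k) v)"
    using B[of "(X ^^ k) v"] c unfolding lowest_weight_pow(1)[OF Y H] by simp
  then have "c + 2 * real k \<le> B" using nz[of k] by simp
  then show False using k c by simp
qed

text \<open>The weight 1 - d is the lowest one of the irreducible module of dimension d.\<close>

definition lowest_weight :: "nat \<Rightarrow> 'a set" where
  "lowest_weight d = {v. Y v = 0 \<and> H v = (1 - real d) *\<^sub>R v}"

text \<open>At the d-th step the coefficient in the lowering formula is zero, so
  \<open>X^d v\<close> is again killed by \<open>Y\<close>. Its weight 1 + d is positive, which is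
  impossible for a nonzero vector.\<close>

lemma lowest_weight_pow_zero:
  assumes "v \<in> lowest_weight d" and "1 \<le> d"
  shows "(X ^^ d) v = 0"
proof -
  have v: "Y v = 0" "H v = (1 - real d) *\<^sub>R v" using assms(1) by (auto simp: lowest_weight_def)
  have "Y ((X ^^ Suc (d - 1)) v) = 0"
    unfolding lowest_weight_pow(2)[OF v] using assms(2) by (simp add: of_nat_diff)
  moreover have "H ((X ^^ d) v) = (1 + real d) *\<^sub>R (X ^^ d) v"
    unfolding lowest_weight_pow(1)[OF v] by simp
  ultimately show ?thesis using assms(2) lowest_weight_pos_zero[of "(X ^^ d) v" "1 + real d"]
    by simp
qed

lemma lowest_weight_pow_nonzero:
  assumes "v \<in> lowest_weight d" and "v \<noteq> 0" and "k < d"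
  shows "(X ^^ k) v \<noteq> 0"
  using assms(3)
proof (induction k)
  case (Suc k)
  have v: "Y v = 0" "H v = (1 - real d) *\<^sub>R v" using assms(1) by (auto simp: lowest_weight_def)
  have "real (Suc k) * (1 - real d + real k) \<noteq> 0" using Suc.prems by simp
  then have "Y ((X ^^ Suc k) v) \<noteq> 0" unfolding lowest_weight_pow(2)[OF v] using Suc by simp
  then show ?case by (intro notI) (simp add: Y_simps)
qed (use assms(2) in simp)

section \<open>Irreducible modules generated by a lowest weight vector\<close>

definition submodule :: "'a set \<Rightarrow> bool" where
  "submodule W \<longleftrightarrow> subspace W \<and> (\<forall>w\<in>W. X w \<in> W \<and> H w \<in> W \<and> Y w \<in> W)"

definition irreducible :: "'a set \<Rightarrow> bool" where
  "irreducible W \<longleftrightarrow> submodule W \<and> W \<noteq> {0} \<and> (\<forall>U. submodule U \<and> U \<subseteq> W \<longrightarrow> U = {0} \<or> U = W)"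

lemma submodule_pow: "submodule W \<Longrightarrow> w \<in> W \<Longrightarrow> (X ^^ k) w \<in> W"
  by (induction k) (auto simp: submodule_def)

definition chain_span :: "nat \<Rightarrow> 'a \<Rightarrow> 'a set" where
  "chain_span d v = span ((\<lambda>i. (X ^^ i) v) ` {..<d})"

lemma submodule_chain_span:
  assumes v: "v \<in> lowest_weight d" and d: "1 \<le> d"
  shows "submodule (chain_span d v)"
proof -
  let ?S = "(\<lambda>i. (X ^^ i) v) ` {..<d}"
  have sub: "subspace (span ?S)" by (rule subspace_span)
  have v': "Y v = 0" "H v = (1 - real d) *\<^sub>R v" using v by (auto simp: lowest_weight_def)
  have S: "(X ^^ i) v \<in> span ?S" if "i < d" for i using that by (intro span_base) auto
  have gen: "f w \<in> span ?S" if "linear f" "\<And>i. i < d \<Longrightarrow> f ((X ^^ i) v) \<in> span ?S" "w \<in> span ?S"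
    for f :: "'a \<Rightarrow> 'a" and w
  proof -
    have "f ` span ?S = span (f ` ?S)" by (rule linear_span_image[OF that(1), symmetric])
    also have "\<dots> \<subseteq> span ?S" using that(2) by (intro span_minimal[OF _ sub]) auto
    finally show ?thesis using imageI[OF that(3)] by (rule subsetD)
  qed
  have "X ((X ^^ i) v) \<in> span ?S" if "i < d" for i
  proof (cases "Suc i < d")
    case True
    then show ?thesis using S[of "Suc i"] by simp
  next
    case False
    then have "Suc i = d" using that by simp
    then have "X ((X ^^ i) v) = 0" using lowest_weight_pow_zero[OF v d] by auto
    then show ?thesis by (simp add: span_zero)
  qed
  moreover have "H ((X ^^ i) v) \<in> span ?S" if "i < d" for i
    unfolding lowest_weight_pow(1)[OF v'] using S[OF that] by (rule span_scale)
  moreover have "Y ((X ^^ i) v) \<in> span ?S" if "i < d" for i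
  proof (cases i)
    case 0
    then show ?thesis using v' by (simp add: span_zero)
  next
    case (Suc k)
    then have "(X ^^ k) v \<in> span ?S" using S[of k] that by simp
    then show ?thesis unfolding Suc lowest_weight_pow(2)[OF v'] by (rule span_scale)
  qed
  ultimately have "X w \<in> span ?S \<and> H w \<in> span ?S \<and> Y w \<in> span ?S" if "w \<in> span ?S" for w
    using gen[OF linear_X _ that] gen[OF linear_H _ that] gen[OF linear_Y _ that] by simp
  then show ?thesis
    unfolding submodule_def chain_span_def using sub by simp
qed

text \<open>Extracts the first possibly nonzero coefficient: the terms above j are pushed past the
  end of the chain. This gives linear independence of a chain and, for submodules, access to its top
  vector.\<close>

lemma chain_pow_sum:
  assumes "(X ^^ d) v = 0" and "j < d" and "\<And>i. i < j \<Longrightarrow> c i = 0"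
  shows "(X ^^ (d - 1 - j)) (\<Sum>i<d. c i *\<^sub>R (X ^^ i) v) = c j *\<^sub>R (X ^^ (d - 1)) v"
proof -
  have "(X ^^ (d - 1 - j)) (\<Sum>i<d. c i *\<^sub>R (X ^^ i) v) =
      (\<Sum>i<d. c i *\<^sub>R (X ^^ (d - 1 - j + i)) v)"
    by (simp add: pow_simps funpow_add)
  also have "\<dots> = (\<Sum>i<d. if i = j then c j *\<^sub>R (X ^^ (d - 1)) v else 0)"
  proof (intro sum.cong refl)
    fix i assume "i \<in> {..<d}"
    consider "i < j" | "i = j" | "i > j" by linarith
    then show "c i *\<^sub>R (X ^^ (d - 1 - j + i)) v = (if i = j then c j *\<^sub>R (X ^^ (d - 1)) v else 0)"
    proof cases
      case 3
      then have "d - 1 - j + i = (d - 1 - j + i - d) + d" using assms(2) by simp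
      then have "(X ^^ (d - 1 - j + i)) v = (X ^^ (d - 1 - j + i - d)) ((X ^^ d) v)"
        using funpow_add[of "d - 1 - j + i - d" d X] by simp
      then show ?thesis using 3 assms(1) by (simp add: pow_simps)
    qed (use assms in auto)
  qed
  finally show ?thesis using assms(2) by simp
qed

lemma dim_chain_span:
  assumes v: "v \<in> lowest_weight d" "v \<noteq> 0" and d: "1 \<le> d"
  shows "dim (chain_span d v) = d"
proof -
  have z: "(X ^^ d) v = 0" using lowest_weight_pow_zero[OF v(1) d] .
  have nz: "(X ^^ (d - 1)) v \<noteq> 0" using lowest_weight_pow_nonzero[OF v] d by simp
  have c0: "c j = 0" if s: "(\<Sum>i<d. c i *\<^sub>R (X ^^ i) v) = 0" and "j < d" for c j
    using that(2)
  proof (induction j rule: less_induct)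
    case (less j)
    have "c j *\<^sub>R (X ^^ (d - 1)) v = 0"
      using chain_pow_sum[OF z less.prems, of c] less s by (simp add: pow_simps)
    then show ?case using nz by simp
  qed
  have inj: "inj_on (\<lambda>i. (X ^^ i) v) {..<d}"
  proof (rule inj_onI)
    fix i j assume ij: "i \<in> {..<d}" "j \<in> {..<d}" "(X ^^ i) v = (X ^^ j) v"
    show "i = j"
    proof (rule ccontr)
      assume ne: "i \<noteq> j"
      \<comment> \<open>Two equal powers would be a linear relation with coefficients 1 and -1,
        contradicting \<open>c0\<close>.\<close>
      let ?c = "\<lambda>k. (if k = i then 1 else 0) - (if k = j then 1 else (0::real))"
      have "(\<Sum>k<d. ?c k *\<^sub>R (X ^^ k) v) = (\<Sum>k<d. if k = i then (X ^^ k) v else 0) -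
          (\<Sum>k<d. if k = j then (X ^^ k) v else 0)"
        unfolding sum_subtractf[symmetric] by (intro sum.cong) (auto simp: algebra_simps)
      also have "\<dots> = 0" using ij by simp
      finally have "?c i = 0" by (rule c0) (use ij in simp)
      then show False using ne by simp
    qed
  qed
  have "independent ((\<lambda>i. (X ^^ i) v) ` {..<d})"
  proof (rule independent_if_scalars_zero)
    fix f x assume s: "(\<Sum>x\<in>(\<lambda>i. (X ^^ i) v) ` {..<d}. f x *\<^sub>R x) = 0" and x: "x \<in> (\<lambda>i. (X ^^ i) v) ` {..<d}"
    then obtain j where j: "j < d" "x = (X ^^ j) v" by auto
    from s have "(\<Sum>i<d. f ((X ^^ i) v) *\<^sub>R (X ^^ i) v) = 0" by (simp add: sum.reindex[OF inj])
    from c0[OF this j(1)] j(2) show "f x = 0" by simp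
  qed simp
  then show ?thesis
    unfolding chain_span_def using card_image[OF inj] by (simp add: dim_eq_card_independent)
qed

text \<open>A nonzero submodule contains, by a suitable power of \<open>X\<close>, a nonzero
  multiple of the top \<open>X^(d-1) v\<close>. From there \<open>Y\<close> descends through the
  whole chain with nonzero factors.\<close>

lemma irreducible_chain_span:
  assumes v: "v \<in> lowest_weight d" "v \<noteq> 0" and d: "1 \<le> d"
  shows "irreducible (chain_span d v)"
  unfolding irreducible_def
proof (intro conjI allI impI)
  show "submodule (chain_span d v)" using submodule_chain_span[OF v(1) d] .
  have "v \<in> chain_span d v" unfolding chain_span_def using d by (intro span_base) (auto intro!: image_eqI[of _ _ 0])
  then show "chain_span d v \<noteq> {0}" using v(2) by blast
  fix U assume U: "submodule U \<and> U \<subseteq> chain_span d v"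
  then have Us: "subspace U" by (simp add: submodule_def)
  show "U = {0} \<or> U = chain_span d v"
  proof (cases "U = {0}")
    case False
    then obtain u where u: "u \<in> U" "u \<noteq> 0" using subspace_0[OF Us] by auto
    have z: "(X ^^ d) v = 0" using lowest_weight_pow_zero[OF v(1) d] .
    have "u \<in> range (\<lambda>c. \<Sum>i<d. c i *\<^sub>R (X ^^ i) v)"
    proof -
      have "u \<in> span ((\<lambda>i. (X ^^ i) v) ` {..<d})" using u(1) U unfolding chain_span_def by blast
      then show ?thesis
      proof (induction rule: span_induct_alt)
        case base
        show ?case by (rule range_eqI[of _ _ "\<lambda>_. 0"]) simp
      next
        case (step a x y)
        then obtain i c where "i < d" "x = (X ^^ i) v" and y: "y = (\<Sum>i<d. c i *\<^sub>R (X ^^ i) v)" by auto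
        then have e: "a *\<^sub>R x = (\<Sum>j<d. if j = i then a *\<^sub>R (X ^^ j) v else 0)" by simp
        have "a *\<^sub>R x + y = (\<Sum>j<d. (c j + (if j = i then a else 0)) *\<^sub>R (X ^^ j) v)"
          unfolding y e sum.distrib[symmetric] by (intro sum.cong) (auto simp: algebra_simps)
        then show ?case by (rule range_eqI[where x = "\<lambda>j. c j + (if j = i then a else 0)"])
      qed
    qed
    then obtain c where c: "u = (\<Sum>i<d. c i *\<^sub>R (X ^^ i) v)" by blast
    have "\<exists>j. j < d \<and> c j \<noteq> 0"
    proof (rule ccontr)
      assume "\<not> ?thesis"
      then have "u = 0" unfolding c by (intro sum.neutral) auto
      then show False using u(2) by blast
    qed
    then obtain j where j: "j < d \<and> c j \<noteq> 0" "\<forall>i<j. \<not> (i < d \<and> c i \<noteq> 0)"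
      using exists_least_iff[of "\<lambda>j. j < d \<and> c j \<noteq> 0"] by blast
    then have "(X ^^ (d - 1 - j)) u = c j *\<^sub>R (X ^^ (d - 1)) v"
      unfolding c by (intro chain_pow_sum[OF z]) auto
    moreover have "(X ^^ (d - 1 - j)) u \<in> U" using submodule_pow U u(1) by blast
    ultimately have "c j *\<^sub>R (X ^^ (d - 1)) v \<in> U" by (simp only:)
    then have "(1 / c j) *\<^sub>R c j *\<^sub>R (X ^^ (d - 1)) v \<in> U" by (rule subspace_scale[OF Us])
    then have top: "(X ^^ (d - 1)) v \<in> U" using j(1) by simp
    have v': "Y v = 0" "H v = (1 - real d) *\<^sub>R v" using v by (auto simp: lowest_weight_def)
    have "k \<le> d - 1 \<Longrightarrow> (X ^^ (d - 1 - k)) v \<in> U" for k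
    proof (induction k)
      case (Suc k)
      define l where "l = d - 1 - Suc k"
      define r where "r = - (real (Suc l) * (1 - real d + real l))"
      have l: "d - 1 - k = Suc l" and "r \<noteq> 0" using Suc.prems by (auto simp: l_def r_def)
      then have "Y ((X ^^ Suc l) v) \<in> U" using Suc U unfolding submodule_def by auto
      then have "r *\<^sub>R (X ^^ l) v \<in> U" unfolding lowest_weight_pow(2)[OF v'] r_def .
      then have "(1 / r) *\<^sub>R r *\<^sub>R (X ^^ l) v \<in> U" by (rule subspace_scale[OF Us])
      then show ?case using \<open>r \<noteq> 0\<close> by (simp add: l_def)
    qed (use top in simp)
    note down = this
    have "(X ^^ i) v \<in> U" if "i < d" for i
    proof -
      have "d - 1 - (d - 1 - i) = i" using that by simp
      then show ?thesis using down[of "d - 1 - i"] by (simp only: diff_le_self)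
    qed
    then have "chain_span d v \<subseteq> U" unfolding chain_span_def by (intro span_minimal[OF _ Us]) auto
    then show ?thesis using U by blast
  qed simp
qed

text \<open>The Casimir operator \<open>H^2 + 2 (X Y + Y X)\<close>, rewritten with
  \<open>Y X = X Y - H\<close> so that on the kernel of \<open>Y\<close> only a polynomial in
  \<open>H\<close> remains.\<close>

definition casimir :: "'a \<Rightarrow> 'a" where
  "casimir u = H (H u) - 2 *\<^sub>R H u + 4 *\<^sub>R X (Y u)"

lemma casimir_Y: "casimir (Y u) = Y (casimir u)"
proof -
  have "X (Y (Y u)) = Y (X (Y u)) + Y (H u) - 2 *\<^sub>R Y u"
    using X_Y[of "Y u"] H_Y[of u] by simp
  then have e: "X (Y (Y u)) = Y (X (Y u)) + Y (H u) - 2 *\<^sub>R Y u" .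
  show ?thesis
    unfolding casimir_def e H_Y H_simps Y_simps
    by (rule euclidean_eqI) (simp add: inner_simps algebra_simps)
qed

lemma linear_casimir: "linear casimir"
  by (rule linearI) (simp_all add: casimir_def H_simps X_simps Y_simps algebra_simps)

lemma subspace_casimir_eigen: "subspace {u. casimir u = c *\<^sub>R u}"
  by (simp add: subspace_def linear_add[OF linear_casimir] linear_scale[OF linear_casimir]
      linear_0[OF linear_casimir] scaleR_add_right mult.commute)

text \<open>The last nonvanishing power of \<open>X\<close> on \<open>W\<close> produces a highest
  weight vector \<open>x\<close>. Its \<open>Y\<close>-chain is a submodule, hence all of
  \<open>W\<close>, and so its length m is the dimension. As the Casimir operator commutes with
  \<open>Y\<close>, its value on \<open>x\<close> spreads over \<open>W\<close>; from weight m - 1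
  and \<open>X x = 0\<close> this value is (m - 1)^2 - 2 (m - 1) + 4 (m - 1) = m^2 - 1.\<close>

lemma casimir_irreducible:
  assumes nil: "\<And>x. (X ^^ n) x = 0" and W: "irreducible W" and "u \<in> W"
  shows "casimir u = ((real (dim W))\<^sup>2 - 1) *\<^sub>R u"
proof -
  have sW: "submodule W" using W by (simp add: irreducible_def)
  then have subW: "subspace W" by (simp add: submodule_def)
  define m where "m = (LEAST m. \<forall>x\<in>W. (X ^^ m) x = 0)"
  have nilW: "\<forall>x\<in>W. (X ^^ m) x = 0"
    unfolding m_def by (rule LeastI[of _ n]) (use nil in blast)
  obtain x0 where x0: "x0 \<in> W" "x0 \<noteq> 0" using W subspace_0[OF subW] unfolding irreducible_def by auto
  have m: "m \<ge> 1" using nilW x0 by (cases m) auto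
  have "\<not> (\<forall>x\<in>W. (X ^^ (m - 1)) x = 0)"
    using not_less_Least[of "m - 1" "\<lambda>m. \<forall>x\<in>W. (X ^^ m) x = 0"] m unfolding m_def by force
  then obtain w where w: "w \<in> W" "(X ^^ (m - 1)) w \<noteq> 0" by blast
  define x where "x = (X ^^ (m - 1)) w"
  have Xx: "X x = 0"
  proof -
    have "X x = (X ^^ Suc (m - 1)) w" by (simp add: x_def)
    then show ?thesis using m nilW w(1) by simp
  qed
  have Hx: "H x = (real m - 1) *\<^sub>R x"
  proof -
    \<comment> \<open>Since \<open>Y w\<close> stays in \<open>W\<close>, the power
      \<open>X^m\<close> kills it together with \<open>w\<close>. The lowering formula then gives
      \<open>X^(m-1) (H w) = - (m - 1) x\<close>, and moving \<open>H\<close> to the front adds 2 (m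
      - 1) \<open>x\<close>: thus \<open>x\<close> is an eigenvector of weight m - 1.\<close>
    have "(X ^^ Suc (m - 1)) w = 0" "(X ^^ Suc (m - 1)) (Y w) = 0"
      using m nilW w(1) sW by (auto simp: submodule_def simp del: funpow.simps)
    then have "real (Suc (m - 1)) *\<^sub>R ((X ^^ (m - 1)) (H w) + real (m - 1) *\<^sub>R (X ^^ (m - 1)) w) = 0"
      using Y_pow[of "m - 1" w] by (simp add: Y_simps del: funpow.simps)
    then have "(X ^^ (m - 1)) (H w) + real (m - 1) *\<^sub>R (X ^^ (m - 1)) w = 0" by simp
    then have "H x = - (real (m - 1) *\<^sub>R x) + (2 * real (m - 1)) *\<^sub>R x"
      unfolding x_def H_pow by (simp add: eq_neg_iff_add_eq_0)
    also have "\<dots> = real (m - 1) *\<^sub>R x"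
      by (rule euclidean_eqI) (simp add: inner_simps algebra_simps)
    finally show ?thesis using m by (simp add: of_nat_diff)
  qed
  interpret s: sl2_rep Y "\<lambda>v. - H v" X by (rule swap)
  have xl: "x \<in> s.lowest_weight m" "x \<noteq> 0"
    using Xx Hx w(2) by (auto simp: s.lowest_weight_def x_def algebra_simps)
  have sub_iff: "s.submodule U \<longleftrightarrow> submodule U" for U
  proof -
    have "- z \<in> U \<longleftrightarrow> z \<in> U" if "subspace U" for z
      using subspace_neg[OF that, of z] subspace_neg[OF that, of "- z"] by auto
    then show ?thesis unfolding s.submodule_def submodule_def by auto
  qed
  have xW: "x \<in> W" unfolding x_def by (rule submodule_pow[OF sW w(1)])
  have "submodule (s.chain_span m x)" using s.submodule_chain_span[OF xl(1) m] sub_iff by blast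
  moreover have "s.chain_span m x \<subseteq> W"
    unfolding s.chain_span_def using s.submodule_pow[OF _ xW] sW sub_iff
    by (intro span_minimal[OF _ subW]) auto
  moreover have "s.chain_span m x \<noteq> {0}" using s.irreducible_chain_span[OF xl m] by (simp add: s.irreducible_def)
  ultimately have Weq: "s.chain_span m x = W" using W unfolding irreducible_def by blast
  then have mW: "m = dim W" using s.dim_chain_span[OF xl m] by simp
  let ?K = "{u. casimir u = ((real m)\<^sup>2 - 1) *\<^sub>R u}"
  have K: "subspace ?K" by (rule subspace_casimir_eigen)
  have "casimir x = ((real m)\<^sup>2 - 1) *\<^sub>R x"
    unfolding casimir_def X_Y[of x] Xx Hx H_simps Y_simps
    by (rule euclidean_eqI) (simp add: inner_simps algebra_simps power2_eq_square)
  then have "casimir ((Y ^^ i) x) = ((real m)\<^sup>2 - 1) *\<^sub>R (Y ^^ i) x" for i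
    by (induction i) (simp_all add: casimir_Y Y_simps)
  then have "W \<subseteq> ?K"
    unfolding Weq[symmetric] s.chain_span_def
    by (intro span_minimal[OF _ K] image_subsetI CollectI)
  then have "u \<in> ?K" using \<open>u \<in> W\<close> by (rule subsetD)
  then have "casimir u = ((real m)\<^sup>2 - 1) *\<^sub>R u" by (rule CollectD)
  then show ?thesis unfolding mW[symmetric] .
qed

text \<open>On vectors killed by \<open>Y\<close> the Casimir equation factors as (H - (1 + d)) (H -
  (1 - d)) u = 0. The vector \<open>z\<close> is the image under the second factor, so it is a
  lowest weight vector of positive weight 1 + d and must vanish. Conversely a nonzero vector of
  weight 1 - d lies in the irreducible module it generates, of dimension d.\<close>

lemma lowest_weight_eq:
  assumes nil: "\<And>x. (X ^^ n) x = 0" and d: "1 \<le> d"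
  shows "{v. Y v = 0} \<inter> span (\<Union>{W. irreducible W \<and> dim W = d}) = lowest_weight d" (is "?L = _")
proof
  let ?K = "{u. casimir u = ((real d)\<^sup>2 - 1) *\<^sub>R u}"
  have K: "subspace ?K" by (rule subspace_casimir_eigen)
  show "?L \<subseteq> lowest_weight d"
  proof
    fix u assume u: "u \<in> ?L"
    have "span (\<Union>{W. irreducible W \<and> dim W = d}) \<subseteq> ?K"
    proof (rule span_minimal[OF _ K], rule subsetI)
      fix w assume "w \<in> \<Union>{W. irreducible W \<and> dim W = d}"
      then obtain W where W: "irreducible W" "dim W = d" "w \<in> W" by blast
      show "w \<in> ?K" using casimir_irreducible[OF nil W(1,3)] unfolding W(2) by (rule CollectI)
    qed
    moreover have "u \<in> span (\<Union>{W. irreducible W \<and> dim W = d})" using u by (rule IntD2)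
    ultimately have "u \<in> ?K" by (rule subsetD)
    then have c: "casimir u = ((real d)\<^sup>2 - 1) *\<^sub>R u" by (rule CollectD)
    have Y: "Y u = 0" using u by simp
    define z where "z = H u + (real d - 1) *\<^sub>R u"
    have HH: "H (H u) = 2 *\<^sub>R H u + ((real d)\<^sup>2 - 1) *\<^sub>R u"
      using c Y by (simp add: casimir_def X_simps algebra_simps)
    have "Y (H u) = 0" using H_Y[of u] Y by (simp add: H_simps)
    then have "Y z = 0" using Y by (simp add: z_def Y_simps)
    moreover have "H z = (real d + 1) *\<^sub>R z"
      unfolding z_def H_simps HH
      by (rule euclidean_eqI) (simp add: inner_simps algebra_simps power2_eq_square)
    moreover have "real d + 1 > 0" by simp
    ultimately have "z = 0" by (rule lowest_weight_pos_zero)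
    then have "H u = - ((real d - 1) *\<^sub>R u)" by (simp only: z_def eq_neg_iff_add_eq_0)
    also have "\<dots> = (1 - real d) *\<^sub>R u" by (simp add: algebra_simps)
    finally have "H u = (1 - real d) *\<^sub>R u" .
    then show "u \<in> lowest_weight d" using Y by (simp add: lowest_weight_def)
  qed
  show "lowest_weight d \<subseteq> ?L"
  proof
    fix v assume v: "v \<in> lowest_weight d"
    have "v \<in> span (\<Union>{W. irreducible W \<and> dim W = d})"
    proof (cases "v = 0")
      case False
      have "v \<in> chain_span d v"
        unfolding chain_span_def using d by (intro span_base) (auto intro!: image_eqI[of _ _ 0])
      then show ?thesis using irreducible_chain_span[OF v False d] dim_chain_span[OF v False d]
        by (intro span_base UnionI[of "chain_span d v"] CollectI conjI)
    qed (simp add: span_zero)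
    moreover have "Y v = 0" using v by (simp add: lowest_weight_def)
    ultimately show "v \<in> ?L" by (intro IntI CollectI)
  qed
qed

text \<open>The vectors killed by \<open>X\<close> that end a chain of more than \<open>j\<close> vectors.\<close>

definition chain_top :: "nat \<Rightarrow> 'a set" where
  "chain_top j = {x. X x = 0 \<and> x \<in> range (X ^^ j)}"

lemma subspace_chain_top: "subspace (chain_top j)"
proof -
  have "subspace (range (X ^^ j))"
    using linear_subspace_image[OF linear_funpow[OF linear_X] subspace_UNIV] .
  moreover have "subspace {x. X x = 0}" by (rule linear_subspace_kernel[OF linear_X])
  ultimately show ?thesis unfolding chain_top_def Collect_conj_eq by (simp add: subspace_inter)
qed

lemma chain_top_Suc: "chain_top (Suc j) \<subseteq> chain_top j"
proof
  fix x assume "x \<in> chain_top (Suc j)"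
  then obtain w where "X x = 0" "x = (X ^^ Suc j) w" unfolding chain_top_def by blast
  then have "X x = 0" "x = (X ^^ j) (X w)" by (simp_all add: funpow_swap1)
  then show "x \<in> chain_top j" unfolding chain_top_def by blast
qed

text \<open>The top of a chain of exactly j + 1 vectors has weight j, so \<open>H\<close> acts by j
  modulo the tops of longer chains. Applying the lowering formula to \<open>X^(j+1) w = 0\<close>
  exhibits \<open>Y w / (j + 1)\<close> as the required preimage.\<close>

lemma chain_top_step:
  assumes "x \<in> chain_top j"
  shows "H x - real j *\<^sub>R x \<in> chain_top (Suc j)"
proof -
  from assms obtain w where x: "X x = 0" "x = (X ^^ j) w" unfolding chain_top_def by blast
  have "X (H x) = 0" using H_X[of x] x(1) by (simp add: H_simps)
  then have 1: "X (H x - real j *\<^sub>R x) = 0" using x(1) by (simp add: X_simps)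
  have "Y ((X ^^ Suc j) w) = 0" using x by (simp add: Y_simps)
  then have "(X ^^ Suc j) (Y w) = real (Suc j) *\<^sub>R ((X ^^ j) (H w) + real j *\<^sub>R x)"
    unfolding Y_pow using x(2) by simp
  also have "(X ^^ j) (H w) + real j *\<^sub>R x = H x - real j *\<^sub>R x"
  proof -
    have Hx: "H x = (X ^^ j) (H w) + (2 * real j) *\<^sub>R x" using H_pow[of j w] x(2) by simp
    show ?thesis unfolding Hx by (rule euclidean_eqI) (simp add: inner_simps algebra_simps)
  qed
  finally have "(X ^^ Suc j) ((1 / real (Suc j)) *\<^sub>R Y w) = H x - real j *\<^sub>R x"
    by (simp add: pow_simps X_simps del: of_nat_Suc)
  then show ?thesis unfolding chain_top_def using 1 by (metis (mono_tags, lifting) mem_Collect_eq rangeI)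
qed

text \<open>An eigenvector whose depth exceeds its eigenvalue can be pushed one step deeper again
  and again, the factor j - (k + i) being nonzero; nilpotency stops this only at zero.\<close>

lemma chain_top_eigen_zero:
  assumes nil: "\<And>x. (X ^^ n) x = 0" and "y \<in> chain_top k" and y: "H y = real j *\<^sub>R y" and "j < k"
  shows "y = 0"
proof -
  have "y \<in> chain_top (k + i)" for i
  proof (induction i)
    case (Suc i)
    have "(real j - real (k + i)) *\<^sub>R y \<in> chain_top (Suc (k + i))"
      using chain_top_step[OF Suc] y by (simp add: scaleR_diff_left)
    then have "(1 / (real j - real (k + i))) *\<^sub>R (real j - real (k + i)) *\<^sub>R y \<in> chain_top (Suc (k + i))"
      by (rule subspace_scale[OF subspace_chain_top])
    moreover have "real j - real (k + i) \<noteq> 0" using assms(4) by simp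
    ultimately show ?case by simp
  qed (use assms(2) in simp)
  from this[of n] obtain w where "y = (X ^^ (n + k)) w" unfolding chain_top_def by (auto simp: add.commute)
  then show ?thesis using nil by (simp add: funpow_add)
qed

text \<open>On \<open>chain_top (Suc j)\<close> the map H - j is injective by the preceding lemma,
  hence bijective by dimension. It can therefore absorb the defect \<open>f x\<close>, which lies
  there, and \<open>x\<close> becomes an exact eigenvector modulo \<open>y\<close>.\<close>

lemma chain_top_eigen_split:
  assumes nil: "\<And>x. (X ^^ n) x = 0" and x: "x \<in> chain_top j"
  obtains y where "y \<in> chain_top (Suc j)" "H (x - y) = real j *\<^sub>R (x - y)"
proof -
  define f where "f y = H y - real j *\<^sub>R y" for y
  let ?F = "chain_top (Suc j)"
  have F: "subspace ?F" by (rule subspace_chain_top)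
  have lf: "linear f"
    by (rule linearI) (simp_all add: f_def H_simps algebra_simps)
  have "f ` ?F \<subseteq> ?F" unfolding f_def using chain_top_step chain_top_Suc by blast
  moreover have "inj_on f ?F"
  proof (rule inj_onI)
    fix y z assume yz: "y \<in> ?F" "z \<in> ?F" "f y = f z"
    then have "H (y - z) = real j *\<^sub>R (y - z)"
      unfolding f_def H_simps by (simp add: algebra_simps)
    then have "y - z = 0"
      by (rule chain_top_eigen_zero[OF nil subspace_diff[OF F yz(1,2)]]) simp
    then show "y = z" by simp
  qed
  then have "dim (f ` ?F) = dim ?F" using F by (intro dim_image_eq[OF lf]) (simp add: span_eq_iff[THEN iffD2])
  moreover have "subspace (f ` ?F)" by (rule linear_subspace_image[OF lf F])
  ultimately have "f ` ?F = ?F" using F by (intro subspace_dim_equal) auto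
  moreover have "f x \<in> ?F" unfolding f_def by (rule chain_top_step[OF x])
  ultimately obtain y where y: "y \<in> ?F" "f x = f y" by blast
  have "H (x - y) = real j *\<^sub>R (x - y)"
    using y(2) unfolding f_def H_simps by (simp add: algebra_simps)
  then show thesis using that y(1) by blast
qed

lemma lowest_weight_up_down:
  assumes v: "v \<in> lowest_weight d" and "k < d"
  shows "\<exists>c. c \<noteq> 0 \<and> (Y ^^ k) ((X ^^ k) v) = c *\<^sub>R v"
  using assms(2)
proof (induction k)
  case 0
  show ?case by (intro exI[of _ 1]) simp
next
  case (Suc k)
  then obtain c where c: "c \<noteq> 0" "(Y ^^ k) ((X ^^ k) v) = c *\<^sub>R v" by auto
  have v': "Y v = 0" "H v = (1 - real d) *\<^sub>R v" using v by (auto simp: lowest_weight_def)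
  define r where "r = - (real (Suc k) * (1 - real d + real k))"
  have "r \<noteq> 0" using Suc.prems by (auto simp: r_def)
  have "(Y ^^ Suc k) ((X ^^ Suc k) v) = (Y ^^ k) (Y ((X ^^ Suc k) v))"
    by (simp add: funpow_swap1)
  also have "\<dots> = r *\<^sub>R c *\<^sub>R v"
    unfolding lowest_weight_pow(2)[OF v'] r_def[symmetric] linear_scale[OF linear_funpow[OF linear_Y]] c(2) ..
  finally show ?case using \<open>r \<noteq> 0\<close> c(1) by (intro exI[of _ "r * c"]) simp
qed

text \<open>The vector \<open>X^(d-1) w\<close> is split into an eigenvector of weight d - 1 and a
  vector \<open>y = X^d u\<close> coming from longer chains. The first is the top of a chain of
  exactly d vectors and is brought back to its bottom \<open>e\<close> by \<open>Y^(d-1)\<close>;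
  the second is reproduced by \<open>X u\<close>. What is left of \<open>w\<close> is killed by
  \<open>X^(d-1)\<close>.\<close>

lemma ker_pow_decomposition:
  assumes nil: "\<And>x. (X ^^ n) x = 0" and d: "1 \<le> d" and w: "(X ^^ d) w = 0"
  obtains e r u where "w = e + r + X u" "e \<in> lowest_weight d" "(X ^^ (d - 1)) r = 0" "(X ^^ Suc d) u = 0"
proof -
  have "X ((X ^^ (d - 1)) w) = (X ^^ Suc (d - 1)) w" by simp
  also have "\<dots> = 0" using d w by simp
  finally have Xw: "X ((X ^^ (d - 1)) w) = 0" .
  then have "(X ^^ (d - 1)) w \<in> chain_top (d - 1)" unfolding chain_top_def by blast
  from chain_top_eigen_split[OF nil this] obtain y where y: "y \<in> chain_top (Suc (d - 1))"
    "H ((X ^^ (d - 1)) w - y) = real (d - 1) *\<^sub>R ((X ^^ (d - 1)) w - y)" .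
  then obtain u where u: "X y = 0" "y = (X ^^ d) u" using d unfolding chain_top_def by auto
  define x where "x = (X ^^ (d - 1)) w - y"
  have Xx: "X x = 0"
    using Xw u(1) by (simp add: x_def X_simps)
  interpret s: sl2_rep Y "\<lambda>v. - H v" X by (rule swap)
  have xl: "x \<in> s.lowest_weight d"
    using Xx y(2) d unfolding s.lowest_weight_def x_def[symmetric] by (simp add: of_nat_diff algebra_simps)
  obtain c where c: "c \<noteq> 0" "(X ^^ (d - 1)) ((Y ^^ (d - 1)) x) = c *\<^sub>R x"
    using s.lowest_weight_up_down[OF xl, of "d - 1"] d by auto
  define e where "e = (1 / c) *\<^sub>R (Y ^^ (d - 1)) x"
  have "Y ((Y ^^ (d - 1)) x) = (Y ^^ Suc (d - 1)) x" by simp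
  also have "\<dots> = 0" using s.lowest_weight_pow_zero[OF xl d] d by simp
  finally have "Y e = 0" by (simp add: e_def Y_simps)
  moreover have "H e = (1 - real d) *\<^sub>R e"
  proof -
    have "- H ((Y ^^ (d - 1)) x) = (1 - real d + 2 * real (d - 1)) *\<^sub>R (Y ^^ (d - 1)) x"
      using xl by (intro s.lowest_weight_pow(1)) (auto simp: s.lowest_weight_def)
    then have "H ((Y ^^ (d - 1)) x) = - ((1 - real d + 2 * real (d - 1)) *\<^sub>R (Y ^^ (d - 1)) x)"
      by (metis minus_minus)
    also have "\<dots> = (1 - real d) *\<^sub>R (Y ^^ (d - 1)) x"
      using d by (simp add: of_nat_diff scaleR_minus_left[symmetric] del: scaleR_minus_left)
    finally show ?thesis by (simp add: e_def H_simps)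
  qed
  ultimately have e: "e \<in> lowest_weight d" by (simp add: lowest_weight_def)
  have Xe: "(X ^^ (d - 1)) e = x" using c by (simp add: e_def pow_simps)
  have "(X ^^ (d - 1)) (X u) = (X ^^ Suc (d - 1)) u" by (simp add: funpow_swap1)
  then have Xu: "(X ^^ (d - 1)) (X u) = y" using d u(2) by simp
  have "(X ^^ (d - 1)) (w - e - X u) = 0" unfolding pow_simps Xe Xu x_def by simp
  moreover have "(X ^^ Suc d) u = 0" using u by simp
  ultimately show thesis using e by (intro that[of e "w - e - X u" u]) auto
qed

end

section \<open>The signature of the top forms\<close>

context symplectic_map
begin

definition top_form :: "nat \<Rightarrow> 'a \<Rightarrow> 'a \<Rightarrow> real" where
  "top_form d x y = om x ((X ^^ (d - 1)) y)"

lemma top_form_simps: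
  "top_form d (x + y) z = top_form d x z + top_form d y z"
  "top_form d x (y + z) = top_form d x y + top_form d x z"
  "top_form d (c *\<^sub>R x) y = c * top_form d x y"
  "top_form d x (c *\<^sub>R y) = c * top_form d x y"
  unfolding top_form_def by (simp_all add: pow_simps om_simps)

lemma top_form_sum_left: "top_form d (\<Sum>a\<in>A. f a) y = (\<Sum>a\<in>A. top_form d (f a) y)"
  unfolding top_form_def by (simp add: om_sum_left)

lemma top_form_sum_right: "top_form d x (\<Sum>a\<in>A. f a) = (\<Sum>a\<in>A. top_form d x (f a))"
  unfolding top_form_def by (simp add: om_sum_right pow_simps)

lemma top_form_sym: "even d \<Longrightarrow> 1 \<le> d \<Longrightarrow> top_form d x y = top_form d y x"
  unfolding top_form_def using om_pow_swap[of x "d - 1" y] by simp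

lemma top_form_orthonormal_sum:
  assumes "finite B" and orth: "\<And>b c. b \<in> B \<Longrightarrow> c \<in> B \<Longrightarrow> b \<noteq> c \<Longrightarrow> top_form d b c = 0" and "b \<in> B"
  shows "top_form d b (\<Sum>c\<in>B. f c *\<^sub>R c) = f b * top_form d b b"
proof -
  have "top_form d b (\<Sum>c\<in>B. f c *\<^sub>R c) = (\<Sum>c\<in>B. if c = b then f b * top_form d b b else 0)"
    unfolding top_form_sum_right
    by (intro sum.cong refl) (use orth[OF \<open>b \<in> B\<close>] in \<open>auto simp: top_form_simps\<close>)
  then show ?thesis using assms(1,3) by simp
qed

lemma top_form_orthonormal_norm:
  assumes "finite B" and orth: "\<And>b c. b \<in> B \<Longrightarrow> c \<in> B \<Longrightarrow> b \<noteq> c \<Longrightarrow> top_form d b c = 0"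
  shows "top_form d (\<Sum>c\<in>B. f c *\<^sub>R c) (\<Sum>c\<in>B. f c *\<^sub>R c) = (\<Sum>c\<in>B. (f c)\<^sup>2 * top_form d c c)"
  unfolding top_form_sum_left
  by (intro sum.cong refl)
    (simp add: top_form_simps top_form_orthonormal_sum[OF assms] power2_eq_square)

lemma span_sum_scaleR:
  assumes "finite B" "x \<in> span B"
  obtains f where "x = (\<Sum>b\<in>B. f b *\<^sub>R b)"
  using assms span_finite[OF assms(1)] by auto

lemma definite_on_span:
  assumes "finite S" and orth: "\<And>b c. b \<in> S \<Longrightarrow> c \<in> S \<Longrightarrow> b \<noteq> c \<Longrightarrow> top_form d b c = 0"
    and s: "\<And>b. b \<in> S \<Longrightarrow> top_form d b b = s" "s * s = 1" and x: "x \<in> span S" "x \<noteq> 0"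
  shows "s * top_form d x x > 0"
proof -
  obtain f where f: "x = (\<Sum>b\<in>S. f b *\<^sub>R b)" using span_sum_scaleR[OF assms(1) x(1)] .
  have "top_form d x x = (\<Sum>b\<in>S. (f b)\<^sup>2 * top_form d b b)"
    unfolding f using orth by (intro top_form_orthonormal_norm[OF assms(1)])
  also have "\<dots> = (\<Sum>b\<in>S. (f b)\<^sup>2) * s" unfolding sum_distrib_right using s(1) by simp
  finally have "s * top_form d x x = (\<Sum>b\<in>S. (f b)\<^sup>2)" using s(2) by (simp add: mult.left_commute)
  moreover have "(\<Sum>b\<in>S. (f b)\<^sup>2) \<noteq> 0"
  proof
    assume "(\<Sum>b\<in>S. (f b)\<^sup>2) = 0"
    then have "f b = 0" if "b \<in> S" for b using that assms(1) by (simp add: sum_nonneg_eq_0_iff)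
    then show False using x(2) unfolding f by simp
  qed
  moreover have "(\<Sum>b\<in>S. (f b)\<^sup>2) \<ge> 0" by (simp add: sum_nonneg)
  ultimately show ?thesis by linarith
qed

end

locale symplectic_sl2 = symplectic_map om X + sl2_rep X H Y
  for om :: "'a::euclidean_space \<Rightarrow> 'a \<Rightarrow> real" and X H Y :: "'a \<Rightarrow> 'a" +
  fixes n :: nat
  assumes nilpotent_X: "(X ^^ n) x = 0"
begin

definition signed_basis :: "nat \<Rightarrow> 'a set \<Rightarrow> bool" where
  "signed_basis d B \<longleftrightarrow> independent B \<and> span B = lowest_weight d \<and>
    (\<forall>v\<in>B. \<forall>w\<in>B. v \<noteq> w \<longrightarrow> top_form d v w = 0) \<and>
    (\<forall>v\<in>B. top_form d v v = 1 \<or> top_form d v v = - 1)"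

text \<open>
  The radical of the form on the kernel of \<open>X\<^sup>d\<close> contains \<open>ker X\<^sup>d\<^sup>-\<^sup>1 + X (ker X\<^sup>d\<^sup>+\<^sup>1)\<close>, which together
  with the lowest weight vectors spans that kernel: so the signature does not depend on \<open>H\<close> and \<open>Y\<close>.
\<close>

lemma definite_subspace_dim_le:
  assumes B: "signed_basis d B" and d: "even d" "1 \<le> d" and s: "s = 1 \<or> s = -1"
    and P: "subspace P" "\<And>x. x \<in> P \<Longrightarrow> (X ^^ d) x = 0"
    and pos: "\<And>x. x \<in> P \<Longrightarrow> x \<noteq> 0 \<Longrightarrow> s * top_form d x x > 0"
  shows "dim P \<le> card {b \<in> B. top_form d b b = s}"
proof (rule ccontr)
  define S where "S = {b \<in> B. top_form d b b = s}"
  assume "\<not> ?thesis"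
  then have less: "card S < dim P" by (simp add: S_def)
  have indB: "independent B" and spB: "span B = lowest_weight d"
    and orth: "\<And>b c. b \<in> B \<Longrightarrow> c \<in> B \<Longrightarrow> b \<noteq> c \<Longrightarrow> top_form d b c = 0"
    and pm: "\<And>b. b \<in> B \<Longrightarrow> top_form d b b = 1 \<or> top_form d b b = - 1"
    using B unfolding signed_basis_def by auto
  have finB: "finite B" using indB by (rule independent_imp_finite)
  have S: "finite S" "S \<subseteq> B" using finB by (auto simp: S_def)
  \<comment> \<open>A map into a space of dimension at most \<open>card S\<close>; a larger
    \<open>P\<close> must contain a nonzero vector in its kernel, that is, one orthogonal to every
    basis vector of sign s.\<close>
  define f where "f x = (\<Sum>b\<in>S. top_form d b x *\<^sub>R b)" for x
  have lf: "linear f"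
    by (rule linearI) (simp_all add: f_def top_form_simps scaleR_add_left sum.distrib scaleR_sum_right)
  have "f ` P \<subseteq> span S"
    unfolding f_def by (intro image_subsetI span_sum span_scale span_base)
  then have "dim (f ` P) \<le> card S" using S(1) by (rule dim_le_card)
  then have "\<not> inj_on f (span P)"
    using dim_image_eq[OF lf, of P] less by auto
  then have "\<not> inj_on f P" using P(1) by (simp add: span_eq_iff[THEN iffD2])
  then obtain x where x: "x \<in> P" "x \<noteq> 0" "f x = 0"
    using linear_inj_on_iff_eq_0[OF lf P(1)] by auto
  have fx: "top_form d b x = 0" if b: "b \<in> S" for b
  proof -
    have "top_form d b (f x) = top_form d b x * top_form d b b"
      unfolding f_def using S orth b by (intro top_form_orthonormal_sum) auto
    then show ?thesis using x(3) b s by (auto simp: S_def top_form_def pow_simps om_simps)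
  qed
  obtain e r u where eru: "x = e + r + X u" "e \<in> lowest_weight d" "(X ^^ (d - 1)) r = 0" "(X ^^ Suc d) u = 0"
    using ker_pow_decomposition[OF nilpotent_X d(2) P(2)[OF x(1)]] .
  have rad: "top_form d y r = 0" for y using eru(3) by (simp add: top_form_def om_simps)
  \<comment> \<open>Here the top form becomes a pairing with \<open>X^d u\<close>, and
    \<open>X^d\<close> moves across to \<open>y\<close>.\<close>
  have rad': "top_form d y (X u) = 0" if "(X ^^ d) y = 0" for y
  proof -
    have "(X ^^ (d - 1)) (X u) = (X ^^ Suc (d - 1)) u" by (simp add: funpow_swap1)
    then have "top_form d y (X u) = om y ((X ^^ d) u)" using d(2) by (simp add: top_form_def)
    also have "\<dots> = (-1) ^ d * om ((X ^^ d) y) u" using om_pow[of d y u] d(1) by simp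
    finally show ?thesis using that by (simp add: om_simps)
  qed
  have ker: "(X ^^ d) e = 0" using lowest_weight_pow_zero[OF eru(2) d(2)] .
  have red: "top_form d y x = top_form d y e" if "(X ^^ d) y = 0" for y
    unfolding eru(1) top_form_simps rad rad'[OF that] by simp
  have xe: "top_form d x x = top_form d e e"
    using red[OF P(2)[OF x(1)]] red[OF ker] top_form_sym[OF d, of x e] by simp
  obtain c where c: "e = (\<Sum>b\<in>B. c b *\<^sub>R b)" using span_sum_scaleR[OF finB, of e] eru(2) spB by auto
  \<comment> \<open>The radical does not affect orthogonality, so \<open>e\<close> has no component
    along \<open>S\<close>. Only basis vectors of the opposite sign contribute to its square, which
    contradicts definiteness on \<open>P\<close>.\<close>
  have c0: "c b = 0" if b: "b \<in> S" for b
  proof -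
    have bB: "b \<in> B" using b S(2) by blast
    then have "(X ^^ d) b = 0" using span_base spB lowest_weight_pow_zero d(2) by blast
    then have "top_form d b e = 0" using red fx[OF b] by simp
    then have "c b * top_form d b b = 0"
      unfolding c using top_form_orthonormal_sum[OF finB orth bB, of c] by simp
    then show ?thesis using pm[OF bB] by auto
  qed
  have "top_form d e e = (\<Sum>b\<in>B. (c b)\<^sup>2 * top_form d b b)"
    unfolding c using orth by (intro top_form_orthonormal_norm[OF finB])
  then have "s * top_form d e e = (\<Sum>b\<in>B. s * ((c b)\<^sup>2 * top_form d b b))"
    by (simp add: sum_distrib_left)
  also have "\<dots> \<le> 0"
  proof (rule sum_nonpos)
    fix b assume b: "b \<in> B"
    show "s * ((c b)\<^sup>2 * top_form d b b) \<le> 0"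
    proof (cases "b \<in> S")
      case False
      then have "s * top_form d b b = -1" using pm[OF b] s b by (auto simp: S_def)
      then have "s * ((c b)\<^sup>2 * top_form d b b) = - (c b)\<^sup>2" by (metis mult.left_commute mult_minus1_right)
      then show ?thesis by simp
    qed (use c0 in simp)
  qed
  finally show False using pos[OF x(1,2)] xe by simp
qed

lemma signed_part_span:
  assumes B: "signed_basis d B" and d: "1 \<le> d" and s: "s = 1 \<or> s = -1"
  defines "S \<equiv> {b \<in> B. top_form d b b = s}"
  shows "dim (span S) = card S" and "\<And>x. x \<in> span S \<Longrightarrow> (X ^^ d) x = 0"
    and "\<And>x. x \<in> span S \<Longrightarrow> x \<noteq> 0 \<Longrightarrow> s * top_form d x x > 0"
proof -
  have indB: "independent B" and spB: "span B = lowest_weight d" 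
    and orth: "\<And>b c. b \<in> B \<Longrightarrow> c \<in> B \<Longrightarrow> b \<noteq> c \<Longrightarrow> top_form d b c = 0"
    using B unfolding signed_basis_def by auto
  have SB: "S \<subseteq> B" by (auto simp: S_def)
  have finB: "finite B" using indB by (rule independent_imp_finite)
  then have finS: "finite S" using SB by (rule rev_finite_subset)
  have "independent S" using independent_mono[OF indB SB] .
  then show "dim (span S) = card S" by (simp add: dim_eq_card_independent)
  show "(X ^^ d) x = 0" if "x \<in> span S" for x
    using that span_mono[OF SB] spB lowest_weight_pow_zero[OF _ d] by blast
  show "s * top_form d x x > 0" if "x \<in> span S" "x \<noteq> 0" for x
    using s orth SB by (intro definite_on_span[OF finS _ _ _ that]) (auto simp: S_def)
qed

text \<open>An isometry that anticommutes with \<open>X\<close> changes the sign of the form, as \<open>d - 1\<close> is odd.\<close>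

lemma anticommuting_isometry_balanced:
  assumes B: "signed_basis d B" and d: "even d" "1 \<le> d"
    and g: "linear g" "\<And>x y. om (g x) (g y) = om x y" "\<And>x. g (X x) = - X (g x)" "inj g"
  shows "card {b \<in> B. top_form d b b = 1} = card {b \<in> B. top_form d b b = - 1}"
proof -
  have gp: "(X ^^ k) (g x) = (-1) ^ k *\<^sub>R g ((X ^^ k) x)" for k x
  proof (induction k)
    case (Suc k)
    have "(X ^^ Suc k) (g x) = (-1) ^ k *\<^sub>R X (g ((X ^^ k) x))" by (simp add: Suc X_simps)
    also have "X (g ((X ^^ k) x)) = - g (X ((X ^^ k) x))" using g(3) by simp
    finally show ?case by simp
  qed simp
  have le: "card {b \<in> B. top_form d b b = s} \<le> card {b \<in> B. top_form d b b = - s}"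
    if s: "s = 1 \<or> s = -1" for s
  proof -
    let ?P = "span {b \<in> B. top_form d b b = s}"
    note P = signed_part_span[OF B d(2) s]
    have "dim (g ` ?P) \<le> card {b \<in> B. top_form d b b = - s}"
    proof (rule definite_subspace_dim_le[OF B d])
      show "- s = 1 \<or> - s = - 1" using s by auto
      show "subspace (g ` ?P)" by (rule linear_subspace_image[OF g(1) subspace_span])
      show "(X ^^ d) y = 0" if "y \<in> g ` ?P" for y
        using that P(2) by (auto simp: gp linear_0[OF g(1)])
      show "- s * top_form d y y > 0" if y: "y \<in> g ` ?P" "y \<noteq> 0" for y
      proof -
        obtain x where x: "x \<in> ?P" "y = g x" using y(1) by blast
        then have "x \<noteq> 0" using y(2) linear_0[OF g(1)] by auto
        have "odd (d - 1)" using d by simp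
        then have "top_form d y y = - top_form d x x"
          unfolding x(2) top_form_def gp by (simp add: om_simps g(2))
        then show ?thesis using P(3)[OF x(1) \<open>x \<noteq> 0\<close>] by simp
      qed
    qed
    moreover have "dim (g ` ?P) = dim ?P"
      by (rule dim_image_eq[OF g(1)]) (use g(4) inj_on_subset in blast)
    ultimately show ?thesis using P(1) by simp
  qed
  from le[of 1] le[of "-1"] show ?thesis by simp
qed

end

text \<open>Sylvester's law of inertia on the common space \<open>ker X^d\<close>: the positive part
  of either basis spans a positive definite subspace, whose dimension is bounded by the positive
  count of the other basis.\<close>

lemma signed_basis_positive_unique:
  assumes "symplectic_sl2 om X H Y n" and "symplectic_sl2 om X H' Y' n'"
    and B: "symplectic_sl2.signed_basis om X H Y d B" and B': "symplectic_sl2.signed_basis om X H' Y' d B'"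
    and d: "even d" "1 \<le> d"
  shows "card {b \<in> B. symplectic_map.top_form om X d b b = 1} =
    card {b \<in> B'. symplectic_map.top_form om X d b b = 1}"
proof -
  interpret a: symplectic_sl2 om X H Y n by fact
  interpret b: symplectic_sl2 om X H' Y' n' by fact
  show ?thesis
  proof (rule antisym)
    note P = a.signed_part_span[OF B d(2), of 1]
    show "card {b \<in> B. a.top_form d b b = 1} \<le> card {b \<in> B'. a.top_form d b b = 1}"
      unfolding P(1)[OF disjI1[OF refl], symmetric]
      by (rule b.definite_subspace_dim_le[OF B' d, of 1, OF _ subspace_span]) (use P(2,3) in auto)
    note P' = b.signed_part_span[OF B' d(2), of 1]
    show "card {b \<in> B'. a.top_form d b b = 1} \<le> card {b \<in> B. a.top_form d b b = 1}"
      unfolding P'(1)[OF disjI1[OF refl], symmetric]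
      by (rule a.definite_subspace_dim_le[OF B d, of 1, OF _ subspace_span]) (use P'(2,3) in auto)
  qed
qed

section \<open>The triple and the involution defined by the chains\<close>

locale symplectic_chains = symplectic_map om X
  for om :: "'a::euclidean_space \<Rightarrow> 'a \<Rightarrow> real" and X :: "'a \<Rightarrow> 'a" +
  fixes I :: "nat set" and v :: "nat \<Rightarrow> 'a" and d :: "nat \<Rightarrow> nat" and eps :: "nat \<Rightarrow> real"
    and st :: "nat \<Rightarrow> nat"
  assumes chains: "chain_family UNIV I v d eps st"
begin

lemma finite_I: "finite I"
  using chains by (simp add: chain_family_def)

lemma
  assumes "a \<in> I"
  shows d_pos: "1 \<le> d a" and st_in: "st a \<in> I" and st_st: "st (st a) = a" and d_st: "d (st a) = d a"
    and eps: "eps a = 1 \<or> eps a = - 1" and st_even: "even (d a) \<Longrightarrow> st a = a"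
    and pow_d: "(X ^^ d a) (v a) = 0"
  using bspec[OF conjunct1[OF conjunct2[OF chains[unfolded chain_family_def]]] assms] by simp_all

lemma pow_ge_d: "a \<in> I \<Longrightarrow> d a \<le> i \<Longrightarrow> (X ^^ i) (v a) = 0"
  by (rule pow_zero_mono[OF pow_d])

lemma om_v: "a \<in> I \<Longrightarrow> b \<in> I \<Longrightarrow>
    om (v a) ((X ^^ k) (v b)) = (if b = st a \<and> k + 1 = d a then eps a else 0)"
  using conjunct1[OF conjunct2[OF conjunct2[OF chains[unfolded chain_family_def]]]] by simp

lemma om_chain: "a \<in> I \<Longrightarrow> b \<in> I \<Longrightarrow> om ((X ^^ i) (v a)) ((X ^^ j) (v b)) =
    (if b = st a \<and> i + j + 1 = d a then (-1) ^ i * eps a else 0)"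
  using om_v[of a b "i + j"] by (simp add: om_pow funpow_add)

abbreviation coord :: "nat \<Rightarrow> nat \<Rightarrow> 'a \<Rightarrow> real" where
  "coord \<equiv> chain_coord v d eps st"

lemma expansion: "y = (\<Sum>a\<in>I. \<Sum>i<d a. coord a i y *\<^sub>R (X ^^ i) (v a))"
  using chains by (simp add: chain_family_def)

lemma coord_chain:
  assumes "a \<in> I" "b \<in> I" "i < d a" "j < d b"
  shows "coord a i ((X ^^ j) (v b)) = (if a = b \<and> i = j then 1 else 0)"
proof -
  have "st a = st b \<longleftrightarrow> a = b" using st_st assms(1,2) by metis
  moreover have "j + (d a - 1 - i) + 1 = d b \<longleftrightarrow> i = j" if "a = b" using that assms by auto
  moreover have "(-1::real) ^ i * (-1) ^ i = 1" by (simp flip: power_mult_distrib)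
  moreover have "eps a * eps a = 1" using eps[OF assms(1)] by auto
  ultimately show ?thesis
    unfolding chain_coord_def using assms st_in
    by (auto simp: om_chain mult.left_commute mult.assoc)
qed

lemma coord_add: "coord a i (x + y) = coord a i x + coord a i y"
  by (simp add: chain_coord_def om_simps algebra_simps)

lemma coord_scale: "coord a i (c *\<^sub>R x) = c * coord a i x"
  by (simp add: chain_coord_def om_simps)

section \<open>Linear maps prescribed on the chain basis and the resulting triple\<close>

definition chain_map :: "(nat \<Rightarrow> nat \<Rightarrow> 'a) \<Rightarrow> 'a \<Rightarrow> 'a" where
  "chain_map w y = (\<Sum>a\<in>I. \<Sum>i<d a. coord a i y *\<^sub>R w a i)"

lemma linear_chain_map: "linear (chain_map w)"
  by (rule linearI)
    (simp_all add: chain_map_def coord_add coord_scale scaleR_add_left sum.distrib scaleR_sum_right)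

lemma chain_map_chain:
  assumes "b \<in> I" "j < d b"
  shows "chain_map w ((X ^^ j) (v b)) = w b j"
proof -
  have "chain_map w ((X ^^ j) (v b)) = (\<Sum>a\<in>I. \<Sum>i<d a. if a = b then if i = j then w b j else 0 else 0)"
    unfolding chain_map_def using assms by (intro sum.cong refl) (simp add: coord_chain)
  also have "\<dots> = (\<Sum>a\<in>I. if a = b then w b j else 0)"
    using assms by (intro sum.cong refl) auto
  finally show ?thesis using assms finite_I by simp
qed

lemma linear_ext_chain:
  fixes f g :: "'a \<Rightarrow> 'b::real_vector"
  assumes "linear f" "linear g" and "\<And>a i. a \<in> I \<Longrightarrow> i < d a \<Longrightarrow> f ((X ^^ i) (v a)) = g ((X ^^ i) (v a))"
  shows "f y = g y"
proof -
  have "f y = (\<Sum>a\<in>I. \<Sum>i<d a. coord a i y *\<^sub>R f ((X ^^ i) (v a)))"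
    by (subst expansion) (simp add: linear_sum[OF assms(1)] linear_scale[OF assms(1)])
  also have "\<dots> = (\<Sum>a\<in>I. \<Sum>i<d a. coord a i y *\<^sub>R g ((X ^^ i) (v a)))"
    using assms(3) by (intro sum.cong refl) simp
  also have "\<dots> = g y"
    by (subst (2) expansion) (simp add: linear_sum[OF assms(2)] linear_scale[OF assms(2)])
  finally show ?thesis .
qed

lemma bilinear_ext_chain:
  assumes "bilinear B" "bilinear C"
    and "\<And>a b i j. a \<in> I \<Longrightarrow> b \<in> I \<Longrightarrow> i < d a \<Longrightarrow> j < d b \<Longrightarrow>
      B ((X ^^ i) (v a)) ((X ^^ j) (v b)) = (C ((X ^^ i) (v a)) ((X ^^ j) (v b)) :: real)"
  shows "B x y = C x y"
proof -
  have lin: "linear (B x)" "linear (\<lambda>x. B x y)" "linear (C x)" "linear (\<lambda>x. C x y)" for x y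
    using assms(1,2) by (simp_all add: bilinear_def)
  have "B ((X ^^ i) (v a)) y = C ((X ^^ i) (v a)) y" if "a \<in> I" "i < d a" for a i y
    using assms(3)[OF that(1) _ that(2)] by (rule linear_ext_chain[OF lin(1) lin(3)])
  then show ?thesis by (rule linear_ext_chain[OF lin(2) lin(4)])
qed

text \<open>Each chain is made a standard irreducible module with weights 1 - d, 3 - d, ..., d - 1.
  The coefficients of \<open>Y\<close> below are then forced by \<open>[X, Y] = H\<close> and
  \<open>Y (v a) = 0\<close>, since i (d - i) - (i + 1) (d - i - 1) = 2 i - d + 1.\<close>

definition H :: "'a \<Rightarrow> 'a" where
  "H = chain_map (\<lambda>a i. (2 * real i - real (d a) + 1) *\<^sub>R (X ^^ i) (v a))"

definition Y :: "'a \<Rightarrow> 'a" where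
  "Y = chain_map (\<lambda>a i. (real i * (real (d a) - real i)) *\<^sub>R (X ^^ (i - 1)) (v a))"

lemma linear_H: "linear H" unfolding H_def by (rule linear_chain_map)

lemma linear_Y: "linear Y" unfolding Y_def by (rule linear_chain_map)

lemma H_chain:
  assumes "a \<in> I"
  shows "H ((X ^^ i) (v a)) = (2 * real i - real (d a) + 1) *\<^sub>R (X ^^ i) (v a)"
proof (cases "i < d a")
  case True
  then show ?thesis unfolding H_def using assms by (simp add: chain_map_chain)
next
  case False
  then show ?thesis using pow_ge_d[OF assms, of i] by (simp add: linear_0[OF linear_H])
qed

text \<open>The formula also holds past the end of the chain. The delicate index is i = d a, where
  \<open>X^(i-1) (v a)\<close> is nonzero but the factor d a - i vanishes; at i = 0 the truncated
  exponent is harmless because of the factor i.\<close>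

lemma Y_chain:
  assumes "a \<in> I"
  shows "Y ((X ^^ i) (v a)) = (real i * (real (d a) - real i)) *\<^sub>R (X ^^ (i - 1)) (v a)"
proof -
  consider "i < d a" | "i = d a" | "d a \<le> i - 1" "d a \<le> i" by linarith
  then show ?thesis
  proof cases
    case 1
    then show ?thesis unfolding Y_def using assms by (simp add: chain_map_chain)
  qed (use pow_ge_d[OF assms] in \<open>simp_all add: linear_0[OF linear_Y]\<close>)
qed

sublocale sl2_rep X H Y
proof (rule sl2_rep.intro)
  show "H (X y) = X (H y) + 2 *\<^sub>R X y" for y
  proof (rule linear_ext_chain[of "\<lambda>y. H (X y)" "\<lambda>y. X (H y) + 2 *\<^sub>R X y"])
    fix a i assume a: "a \<in> I"
    have "H (X ((X ^^ i) (v a))) = (2 * real (Suc i) - real (d a) + 1) *\<^sub>R X ((X ^^ i) (v a))"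
      using H_chain[OF a, of "Suc i"] by simp
    then show "H (X ((X ^^ i) (v a))) = X (H ((X ^^ i) (v a))) + 2 *\<^sub>R X ((X ^^ i) (v a))"
      unfolding H_chain[OF a] linear_scale[OF linear_X] scaleR_add_left[symmetric] by simp
  qed (use linear_compose[OF linear_X linear_H] linear_compose[OF linear_H linear_X] linear_X in
      \<open>auto simp: comp_def intro!: linear_compose_add linear_compose_scale_right\<close>)
  show "H (Y y) = Y (H y) - 2 *\<^sub>R Y y" for y
  proof (rule linear_ext_chain[of "\<lambda>y. H (Y y)" "\<lambda>y. Y (H y) - 2 *\<^sub>R Y y"])
    fix a i assume a: "a \<in> I"
    show "H (Y ((X ^^ i) (v a))) = Y (H ((X ^^ i) (v a))) - 2 *\<^sub>R Y ((X ^^ i) (v a))"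
      unfolding H_chain[OF a] Y_chain[OF a] linear_scale[OF linear_H] linear_scale[OF linear_Y]
        scaleR_scaleR scaleR_diff_left[symmetric]
      by (cases i) (simp_all add: algebra_simps del: funpow.simps)
  qed (use linear_compose[OF linear_Y linear_H] linear_compose[OF linear_H linear_Y] linear_Y in
      \<open>auto simp: comp_def intro!: linear_compose_sub linear_compose_scale_right\<close>)
  show "X (Y y) = Y (X y) + H y" for y
  proof (rule linear_ext_chain[of "\<lambda>y. X (Y y)" "\<lambda>y. Y (X y) + H y"])
    fix a i assume a: "a \<in> I"
    have YX: "Y (X ((X ^^ i) (v a))) = (real (Suc i) * (real (d a) - real (Suc i))) *\<^sub>R (X ^^ i) (v a)"
      using Y_chain[OF a, of "Suc i"] by simp
    have XY: "X (Y ((X ^^ i) (v a))) = (real i * (real (d a) - real i)) *\<^sub>R (X ^^ i) (v a)"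
      unfolding Y_chain[OF a] linear_scale[OF linear_X] by (cases i) simp_all
    show "X (Y ((X ^^ i) (v a))) = Y (X ((X ^^ i) (v a))) + H ((X ^^ i) (v a))"
      unfolding XY YX H_chain[OF a] scaleR_add_left[symmetric] by (simp add: algebra_simps)
  qed (use linear_compose[OF linear_Y linear_X] linear_compose[OF linear_X linear_Y] linear_H in
      \<open>auto simp: comp_def intro!: linear_compose_add\<close>)
qed (rule linear_X linear_H linear_Y)+

text \<open>Vectors with nonzero pairing satisfy i + j + 1 = d, so their weights add up to
  zero.\<close>

lemma om_H: "om (H x) y = - om x (H y)"
proof (rule bilinear_ext_chain[of "\<lambda>x y. om (H x) y" "\<lambda>x y. - om x (H y)"])
  fix a b i j assume ab: "a \<in> I" "b \<in> I"
  show "om (H ((X ^^ i) (v a))) ((X ^^ j) (v b)) = - om ((X ^^ i) (v a)) (H ((X ^^ j) (v b)))"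
  proof (cases "b = st a \<and> i + j + 1 = d a")
    case True
    then have "real (d a) = real i + real j + 1" "d b = d a" using d_st[OF ab(1)] by auto
    then show ?thesis
      unfolding H_chain[OF ab(1)] H_chain[OF ab(2)] om_simps om_chain[OF ab]
      by (simp add: algebra_simps)
  next
    case False
    then show ?thesis
      unfolding H_chain[OF ab(1)] H_chain[OF ab(2)] om_simps om_chain[OF ab] by auto
  qed
qed (use bilinear_om linear_H in \<open>auto simp: bilinear_def linear_iff om_simps\<close>)

text \<open>Lowering either vector gives a nonzero pairing only if i + j = d. Then both coefficients
  equal i j, and the two pairings differ by the sign of one extra power of \<open>X\<close>.\<close>

lemma om_Y: "om (Y x) y = - om x (Y y)"
proof (rule bilinear_ext_chain[of "\<lambda>x y. om (Y x) y" "\<lambda>x y. - om x (Y y)"])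
  fix a b i j assume ab: "a \<in> I" "b \<in> I" and ij: "i < d a" "j < d b"
  show "om (Y ((X ^^ i) (v a))) ((X ^^ j) (v b)) = - om ((X ^^ i) (v a)) (Y ((X ^^ j) (v b)))"
  proof (cases "b = st a \<and> i + j = d a")
    case True
    then obtain i' j' where [simp]: "i = Suc i'" "j = Suc j'"
      using ij d_st[OF ab(1)] by (cases i; cases j) auto
    have "i + j = d a" using True by blast
    then have "real (d a) = real i + real j" "d b = d a" using True d_st[OF ab(1)] by auto
    then show ?thesis
      unfolding Y_chain[OF ab(1)] Y_chain[OF ab(2)] om_simps om_chain[OF ab]
      using True by (simp add: algebra_simps)
  next
    case False
    then show ?thesis
      unfolding Y_chain[OF ab(1)] Y_chain[OF ab(2)] om_simps om_chain[OF ab]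
      using ij d_st[OF ab(1)] by (cases i; cases j) auto
  qed
qed (use bilinear_om linear_Y in \<open>auto simp: bilinear_def linear_iff om_simps\<close>)

section \<open>Signed bases read off the chains\<close>

lemma inj_v: "inj_on v I"
proof (rule inj_onI)
  fix a b assume ab: "a \<in> I" "b \<in> I" "v a = v b"
  have "om (v a) ((X ^^ (d a - 1)) (v (st a))) \<noteq> 0"
    using om_v[OF ab(1) st_in[OF ab(1)]] eps[OF ab(1)] d_pos[OF ab(1)] by auto
  then have "st a = st b"
    using om_v[OF ab(2) st_in[OF ab(1)], of "d a - 1"] ab(3) by (auto split: if_splits)
  then show "a = b" using st_st ab by metis
qed

text \<open>Coordinates are pairings with chain vectors. A lowest weight vector pairs to zero with
  every vector below the top of its chain, as that is a multiple of a value of \<open>Y\<close>, and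
  with the top of a chain of length different from \<eta>, as the weights do not cancel. Only the
  coordinates along the \<open>v a\<close> with d a = \<eta> survive.\<close>

lemma lowest_weight_chain:
  "lowest_weight \<eta> = span (v ` {a \<in> I. d a = \<eta>})"
proof
  have "v a \<in> lowest_weight \<eta>" if "a \<in> I" "d a = \<eta>" for a
    using H_chain[OF that(1), of 0] Y_chain[OF that(1), of 0] that(2) by (simp add: lowest_weight_def)
  moreover have "subspace (lowest_weight \<eta>)"
    by (simp add: lowest_weight_def subspace_def H_simps Y_simps scaleR_add_right mult.commute)
  ultimately show "span (v ` {a \<in> I. d a = \<eta>}) \<subseteq> lowest_weight \<eta>"
    by (intro span_minimal) auto
  show "lowest_weight \<eta> \<subseteq> span (v ` {a \<in> I. d a = \<eta>})"
  proof
    fix y assume "y \<in> lowest_weight \<eta>"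
    then have y: "Y y = 0" "H y = (1 - real \<eta>) *\<^sub>R y" by (auto simp: lowest_weight_def)
    have z: "om y ((X ^^ j) (v b)) = 0" if b: "b \<in> I" and j: "\<not> (j = d b - 1 \<and> d b = \<eta>)" "j < d b" for b j
    proof (cases "j = d b - 1")
      case True
      have "(1 - real \<eta>) * om y ((X ^^ j) (v b)) = - ((2 * real j - real (d b) + 1) * om y ((X ^^ j) (v b)))"
        using om_H[of y "(X ^^ j) (v b)"] unfolding y(2) H_chain[OF b] by (simp add: om_simps)
      then have "(1 - real \<eta> + (2 * real j - real (d b) + 1)) * om y ((X ^^ j) (v b)) = 0"
        by (simp add: algebra_simps)
      moreover have "1 - real \<eta> + (2 * real j - real (d b) + 1) \<noteq> 0"
        using True j by (simp add: of_nat_diff)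
      ultimately show ?thesis by simp
    next
      case False
      have "om y (Y ((X ^^ Suc j) (v b))) = 0" using om_Y[of y "(X ^^ Suc j) (v b)"] y(1) by (simp add: om_simps)
      moreover have "real (Suc j) * (real (d b) - real (Suc j)) \<noteq> 0" using False j by auto
      ultimately show ?thesis unfolding Y_chain[OF b] by (simp add: om_simps del: of_nat_Suc)
    qed
    have "y = (\<Sum>a\<in>I. \<Sum>i<d a. coord a i y *\<^sub>R (X ^^ i) (v a))" by (rule expansion)
    also have "\<dots> \<in> span (v ` {a \<in> I. d a = \<eta>})"
    proof (intro span_sum)
      fix a i assume a: "a \<in> I" and i: "i \<in> {..<d a}"
      show "coord a i y *\<^sub>R (X ^^ i) (v a) \<in> span (v ` {a \<in> I. d a = \<eta>})"
      proof (cases "i = 0 \<and> d a = \<eta>")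
        case True
        then show ?thesis using a by (intro span_scale span_base) auto
      next
        case False
        have "om y ((X ^^ (d a - 1 - i)) (v (st a))) = 0"
          using False i d_st[OF a] by (intro z[OF st_in[OF a]]) auto
        then show ?thesis by (simp add: chain_coord_def span_zero)
      qed
    qed
    finally show "y \<in> span (v ` {a \<in> I. d a = \<eta>})" .
  qed
qed

lemma top_form_v:
  "a \<in> I \<Longrightarrow> b \<in> I \<Longrightarrow> even (d a) \<Longrightarrow> top_form (d a) (v a) (v b) = (if a = b then eps a else 0)"
  unfolding top_form_def using om_v[of a b "d a - 1"] st_even d_pos[of a] by auto

lemma independent_v: "independent (v ` {a \<in> I. d a = \<eta>})"
proof (rule independent_if_scalars_zero)
  fix f x assume s: "(\<Sum>x\<in>v ` {a \<in> I. d a = \<eta>}. f x *\<^sub>R x) = 0" and "x \<in> v ` {a \<in> I. d a = \<eta>}"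
  then obtain a where a: "a \<in> I" "d a = \<eta>" "x = v a" by blast
  have inj: "inj_on v {a \<in> I. d a = \<eta>}" using inj_v by (rule inj_on_subset) auto
  have "0 = coord a 0 (\<Sum>b\<in>{a \<in> I. d a = \<eta>}. f (v b) *\<^sub>R v b)"
    using s by (simp add: sum.reindex[OF inj] chain_coord_def om_simps)
  also have "\<dots> = (\<Sum>b\<in>{a \<in> I. d a = \<eta>}. f (v b) * coord a 0 (v b))"
    by (simp add: chain_coord_def om_sum_left om_simps sum_distrib_left algebra_simps)
  also have "\<dots> = (\<Sum>b\<in>{a \<in> I. d a = \<eta>}. if b = a then f (v a) else 0)"
  proof (intro sum.cong refl)
    fix b assume b: "b \<in> {a \<in> I. d a = \<eta>}"
    then show "f (v b) * coord a 0 (v b) = (if b = a then f (v a) else 0)"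
      using coord_chain[of a b 0 0] a d_pos[of a] by auto
  qed
  also have "\<dots> = f x" using a finite_I by simp
  finally show "f x = 0" by simp
qed (use finite_I in simp)

text \<open>The condition on \<open>eps\<close> is exactly isometry: paired vectors have i + j = d a
  - 1, so the alternating factors contribute (-1)^(d a - 1), which must cancel the change from
  \<open>eps a\<close> to \<open>eps (\<pi> a)\<close>.\<close>

lemma anticommuting_involution:
  assumes pi: "\<And>a. a \<in> I \<Longrightarrow> \<pi> a \<in> I" "\<And>a. a \<in> I \<Longrightarrow> \<pi> (\<pi> a) = a" "\<And>a. a \<in> I \<Longrightarrow> d (\<pi> a) = d a"
    "\<And>a. a \<in> I \<Longrightarrow> st (\<pi> a) = \<pi> (st a)" "\<And>a. a \<in> I \<Longrightarrow> eps (\<pi> a) = (-1) ^ (d a - 1) * eps a"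
  obtains \<tau> where "linear \<tau>" "\<And>y. \<tau> (\<tau> y) = y" "\<And>y. \<tau> (X y) = - X (\<tau> y)"
    "\<And>x y. om (\<tau> x) (\<tau> y) = om x y"
proof -
  define \<tau> where "\<tau> = chain_map (\<lambda>a i. (-1) ^ i *\<^sub>R (X ^^ i) (v (\<pi> a)))"
  have lin: "linear \<tau>" unfolding \<tau>_def by (rule linear_chain_map)
  have t: "\<tau> ((X ^^ i) (v a)) = (-1) ^ i *\<^sub>R (X ^^ i) (v (\<pi> a))" if a: "a \<in> I" for a i
  proof (cases "i < d a")
    case True
    then show ?thesis unfolding \<tau>_def using a by (simp add: chain_map_chain)
  next
    case False
    then show ?thesis
      using pow_ge_d[OF a, of i] pow_ge_d[OF pi(1)[OF a], of i] pi(3)[OF a] by (simp add: linear_0[OF lin])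
  qed
  have sq: "(-1::real) ^ i * (-1) ^ i = 1" for i by (simp flip: power_mult_distrib)
  have inv: "\<tau> (\<tau> y) = y" for y
  proof (rule linear_ext_chain[of "\<lambda>y. \<tau> (\<tau> y)" "\<lambda>y. y"])
    fix a i assume a: "a \<in> I"
    show "\<tau> (\<tau> ((X ^^ i) (v a))) = (X ^^ i) (v a)"
      using sq[of i] by (simp add: t[OF a] t[OF pi(1)[OF a]] linear_scale[OF lin] pi(2)[OF a])
  qed (use linear_compose[OF lin lin] in \<open>auto simp: comp_def linear_ident\<close>)
  have anti: "\<tau> (X y) = - X (\<tau> y)" for y
  proof (rule linear_ext_chain[of "\<lambda>y. \<tau> (X y)" "\<lambda>y. - X (\<tau> y)"])
    fix a i assume a: "a \<in> I"
    show "\<tau> (X ((X ^^ i) (v a))) = - X (\<tau> ((X ^^ i) (v a)))"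
      using t[OF a, of "Suc i"] by (simp add: t[OF a] linear_scale[OF linear_X])
  qed (use linear_compose[OF lin linear_X] linear_compose[OF linear_X lin] in
      \<open>auto simp: comp_def intro!: linear_compose_neg\<close>)
  have iso: "om (\<tau> x) (\<tau> y) = om x y" for x y
  proof (rule bilinear_ext_chain[of "\<lambda>x y. om (\<tau> x) (\<tau> y)" om])
    fix a b i j assume ab: "a \<in> I" "b \<in> I"
    have iff: "\<pi> b = st (\<pi> a) \<longleftrightarrow> b = st a" using pi(2,4) ab st_in by metis
    have "om (\<tau> ((X ^^ i) (v a))) (\<tau> ((X ^^ j) (v b))) =
        (-1) ^ i * ((-1) ^ j * om ((X ^^ i) (v (\<pi> a))) ((X ^^ j) (v (\<pi> b))))"
      by (simp add: t[OF ab(1)] t[OF ab(2)] om_simps)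
    also have "\<dots> = om ((X ^^ i) (v a)) ((X ^^ j) (v b))"
    proof (cases "b = st a \<and> i + j + 1 = d a")
      case True
      then have "d a - 1 = i + j" by arith
      then have e: "eps (\<pi> a) = (-1) ^ i * (-1) ^ j * eps a" using pi(5)[OF ab(1)] by (simp add: power_add)
      have "(-1) ^ i * ((-1) ^ j * ((-1) ^ i * eps (\<pi> a))) =
          ((-1) ^ i * (-1) ^ i) * ((-1) ^ j * (-1) ^ j) * ((-1) ^ i * eps a)"
        unfolding e by (simp only: ac_simps)
      then show ?thesis
        unfolding om_chain[OF ab] om_chain[OF pi(1)[OF ab(1)] pi(1)[OF ab(2)]] iff pi(3)[OF ab(1)]
        using True by (simp add: sq)
    next
      case False
      then show ?thesis
        unfolding om_chain[OF ab] om_chain[OF pi(1)[OF ab(1)] pi(1)[OF ab(2)]] iff pi(3)[OF ab(1)] by auto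
    qed
    finally show "om (\<tau> ((X ^^ i) (v a))) (\<tau> ((X ^^ j) (v b))) = om ((X ^^ i) (v a)) ((X ^^ j) (v b))" .
  qed (use bilinear_om lin in \<open>auto simp: bilinear_def linear_iff om_simps\<close>)
  show thesis by (rule that[OF lin inv anti iso])
qed

text \<open>For even length \<open>st\<close> is the identity, and equal counts allow a bijection
  from positive to negative chains, used together with its inverse. For odd length the required sign
  factor is 1, so the identity serves and compatibility with \<open>st\<close> is automatic.\<close>

lemma sign_exchange:
  assumes bal: "\<And>\<eta>. even \<eta> \<Longrightarrow> card {a \<in> I. d a = \<eta> \<and> eps a = 1} = card {a \<in> I. d a = \<eta> \<and> eps a = - 1}"
  obtains \<pi> where "\<And>a. a \<in> I \<Longrightarrow> \<pi> a \<in> I" "\<And>a. a \<in> I \<Longrightarrow> \<pi> (\<pi> a) = a" "\<And>a. a \<in> I \<Longrightarrow> d (\<pi> a) = d a"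
    "\<And>a. a \<in> I \<Longrightarrow> st (\<pi> a) = \<pi> (st a)" "\<And>a. a \<in> I \<Longrightarrow> eps (\<pi> a) = (-1) ^ (d a - 1) * eps a"
proof -
  define P where "P \<eta> = {a \<in> I. d a = \<eta> \<and> eps a = 1}" for \<eta>
  define M where "M \<eta> = {a \<in> I. d a = \<eta> \<and> eps a = - 1}" for \<eta>
  have "\<exists>f. even \<eta> \<longrightarrow> bij_betw f (P \<eta>) (M \<eta>)" for \<eta>
    using finite_same_card_bij[of "P \<eta>" "M \<eta>"] bal[of \<eta>] finite_I by (auto simp: P_def M_def)
  then obtain f where f: "\<And>\<eta>. even \<eta> \<Longrightarrow> bij_betw (f \<eta>) (P \<eta>) (M \<eta>)" by metis
  define g where "g \<eta> = inv_into (P \<eta>) (f \<eta>)" for \<eta>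
  define \<pi> where "\<pi> a = (if odd (d a) then a else if eps a = 1 then f (d a) a else g (d a) a)" for a
  have main: "\<pi> a \<in> I \<and> \<pi> (\<pi> a) = a \<and> d (\<pi> a) = d a \<and> eps (\<pi> a) = (-1) ^ (d a - 1) * eps a"
    if a: "a \<in> I" for a
  proof (cases "odd (d a)")
    case True
    then show ?thesis using a by (simp add: \<pi>_def)
  next
    case False
    then have fb: "bij_betw (f (d a)) (P (d a)) (M (d a))" using f by simp
    have "odd (d a - 1)" using False d_pos[OF a] by simp
    then have sgn: "(-1::real) ^ (d a - 1) = -1" by simp
    show ?thesis
    proof (cases "eps a = 1")
      case True
      then have aP: "a \<in> P (d a)" using a by (simp add: P_def)
      then have "f (d a) a \<in> M (d a)" using fb by (rule bij_betwE[rule_format, rotated])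
      moreover have "g (d a) (f (d a) a) = a"
        unfolding g_def using fb aP by (intro inv_into_f_f) (auto simp: bij_betw_def)
      ultimately show ?thesis using True False sgn by (auto simp: \<pi>_def M_def)
    next
      case neg: False
      then have aM: "a \<in> M (d a)" using a eps[OF a] by (auto simp: M_def)
      then have "g (d a) a \<in> P (d a)"
        unfolding g_def using fb by (intro inv_into_into) (auto simp: bij_betw_def)
      moreover have "f (d a) (g (d a) a) = a"
        unfolding g_def using fb aM by (intro f_inv_into_f) (auto simp: bij_betw_def)
      ultimately show ?thesis using neg False sgn eps[OF a] by (auto simp: \<pi>_def P_def)
    qed
  qed
  have "st (\<pi> a) = \<pi> (st a)" if a: "a \<in> I" for a
  proof (cases "odd (d a)")
    case True
    then show ?thesis using d_st[OF a] by (simp add: \<pi>_def)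
  next
    case False
    then show ?thesis using main[OF a] st_even a by simp
  qed
  then show thesis using main that by blast
qed

end

section \<open>Jordan blocks and chains\<close>

text \<open>Counting blocks of a given positive size and eigenvalue depends on the matrix alone;
  blocks of size 0 are ruled out by \<open>jordan_nf\<close>.\<close>

lemma jordan_nf_mset_unique:
  fixes A :: "'a::field Matrix.mat"
  assumes "jordan_nf A xs" "jordan_nf A ys"
  shows "mset xs = mset ys"
proof (rule multiset_eqI)
  fix p :: "nat \<times> 'a"
  obtain k e where p: "p = (k, e)" by fastforce
  show "count (mset xs) p = count (mset ys) p"
  proof (cases "k = 0")
    case True
    then have "p \<notin> set xs" "p \<notin> set ys" using assms p unfolding jordan_nf_def by force+
    then have "count (mset xs) p = 0" "count (mset ys) p = 0" by simp_all
    then show ?thesis by (simp only:)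
  next
    case False
    then show ?thesis
      using compute_nr_of_jordan_blocks[OF assms(1) False, of e]
        compute_nr_of_jordan_blocks[OF assms(2) False, of e]
      by (simp add: p count_mset count_list_eq_length_filter)
  qed
qed

lemma jordan_partition_eqI:
  assumes "jordan_nf (to_mat X) xs"
  shows "jordan_partition X = mset (map fst xs)"
  unfolding jordan_partition_def
proof (rule the_equality)
  show "\<exists>n_as. jordan_nf (to_mat X) n_as \<and> mset (map fst xs) = mset (map fst n_as)"
    using assms by blast
  fix D assume "\<exists>n_as. jordan_nf (to_mat X) n_as \<and> D = mset (map fst n_as)"
  then obtain ys where "jordan_nf (to_mat X) ys" "D = mset (map fst ys)" by blast
  then show "D = mset (map fst xs)" using jordan_nf_mset_unique[OF assms, of ys] by (simp add: mset_map)
qed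

text \<open>
  The chain vectors in the order of the columns of the Jordan matrix: the entry \<open>(a, k)\<close> stands
  for \<open>X\<^sup>k (v a)\<close>, and each block starts with \<open>k = d a - 1\<close>.
\<close>

definition chain_index :: "(nat \<Rightarrow> nat) \<Rightarrow> nat list \<Rightarrow> (nat \<times> nat) list" where
  "chain_index d as = concat (map (\<lambda>a. map (\<lambda>i. (a, d a - 1 - i)) [0..<d a]) as)"

lemma chain_index_Cons:
  "chain_index d (a # as) = map (\<lambda>i. (a, d a - 1 - i)) [0..<d a] @ chain_index d as"
  by (simp add: chain_index_def)

lemma length_chain_index: "length (chain_index d as) = sum_list (map d as)"
  by (induction as) (simp_all add: chain_index_Cons chain_index_def)

lemma set_chain_index: "set (chain_index d as) = (SIGMA a:set as. {..<d a})"
proof (induction as)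
  case Nil
  show ?case by (simp add: chain_index_def)
next
  case (Cons a as)
  have "(\<lambda>i. (a, d a - 1 - i)) ` {0..<d a} = {a} \<times> {..<d a}"
  proof (intro equalityI subsetI)
    fix p assume "p \<in> {a} \<times> {..<d a}"
    then have "p = (a, d a - 1 - (d a - 1 - snd p))" "d a - 1 - snd p \<in> {0..<d a}" by auto
    then show "p \<in> (\<lambda>i. (a, d a - 1 - i)) ` {0..<d a}" by (rule image_eqI)
  qed auto
  then show ?case using Cons by (auto simp: chain_index_Cons simp del: One_nat_def)
qed

lemma distinct_chain_index: "distinct as \<Longrightarrow> distinct (chain_index d as)"
proof (induction as)
  case Nil
  show ?case by (simp add: chain_index_def)
next
  case (Cons a as)
  have "inj_on (\<lambda>i. (a, d a - 1 - i)) {0..<d a}" by (rule inj_onI) auto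
  then show ?case using Cons by (auto simp: chain_index_Cons set_chain_index distinct_map simp del: One_nat_def)
qed

text \<open>An entry 1 in row i and column j says that \<open>X\<close> sends the j-th chain vector
  to the i-th. Descending powers put the image immediately before its source, that is, on the
  superdiagonal.\<close>

lemma jordan_matrix_chain_index:
  assumes "distinct as" and "i < sum_list (map d as)" and "j < sum_list (map d as)"
  shows "jordan_matrix (map (\<lambda>a. (d a, 0::real)) as) $$ (i, j) =
    (if fst (chain_index d as ! i) = fst (chain_index d as ! j) \<and>
        snd (chain_index d as ! i) = Suc (snd (chain_index d as ! j)) then 1 else 0)"
  using assms
proof (induction as arbitrary: i j)
  case (Cons a as)
  define N where "N = sum_list (map d as)"
  have sf: "sum_list (map fst (map (\<lambda>a. (d a, 0::real)) as)) = N" by (simp add: N_def comp_def)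
  have J: "jordan_matrix (map (\<lambda>a. (d a, 0::real)) (a # as)) = four_block_mat
      (jordan_block (d a) 0) (0\<^sub>m (d a) N) (0\<^sub>m N (d a)) (jordan_matrix (map (\<lambda>a. (d a, 0)) as))"
    using jordan_matrix_Cons[of "d a" "0::real" "map (\<lambda>a. (d a, 0)) as"] unfolding sf by simp
  have dims: "dim_row (jordan_matrix (map (\<lambda>a. (d a, 0::real)) as)) = N"
    "dim_col (jordan_matrix (map (\<lambda>a. (d a, 0::real)) as)) = N"
    unfolding jordan_matrix_dim sf by simp_all
  have ij: "i < d a + N" "j < d a + N" using Cons.prems by (simp_all add: N_def)
  have lo: "chain_index d (a # as) ! k = (a, d a - 1 - k)" if "k < d a" for k
    using that by (simp add: chain_index_Cons nth_append)
  have hi: "chain_index d (a # as) ! k = chain_index d as ! (k - d a)" if "\<not> k < d a" for k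
    using that by (simp add: chain_index_Cons nth_append)
  have ne: "fst (chain_index d as ! (k - d a)) \<noteq> a" if "\<not> k < d a" "k < d a + N" for k
  proof -
    have "chain_index d as ! (k - d a) \<in> set (chain_index d as)"
      using that by (intro nth_mem) (simp add: length_chain_index N_def)
    then show ?thesis using Cons.prems(1) by (auto simp: set_chain_index)
  qed
  have e: "jordan_matrix (map (\<lambda>a. (d a, 0::real)) (a # as)) $$ (i, j) =
      (if i < d a then if j < d a then jordan_block (d a) 0 $$ (i, j) else 0\<^sub>m (d a) N $$ (i, j - d a)
       else if j < d a then 0\<^sub>m N (d a) $$ (i - d a, j)
       else jordan_matrix (map (\<lambda>a. (d a, 0)) as) $$ (i - d a, j - d a))"
    unfolding J using ij by (subst index_mat_four_block) (auto simp: dims N_def comp_def)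
  consider "i < d a" "j < d a" | "i < d a" "\<not> j < d a" | "\<not> i < d a" "j < d a" | "\<not> i < d a" "\<not> j < d a"
    by blast
  then show ?case
  proof cases
    case 1
    then have "(d a - 1 - i = Suc (d a - 1 - j)) \<longleftrightarrow> Suc i = j" by auto
    then show ?thesis unfolding e using 1 by (simp add: lo del: One_nat_def)
  next
    case 2
    then show ?thesis unfolding e using ij ne[OF 2(2) ij(2)] by (simp add: lo hi)
  next
    case 3
    then show ?thesis unfolding e using ij ne[OF 3(1) ij(1)] by (simp add: lo hi)
  next
    case 4
    then show ?thesis
      unfolding e using ij Cons.IH[of "i - d a" "j - d a"] Cons.prems(1) by (simp add: hi N_def)
  qed
qed simp

lemma index_mult_mat_sum:
  assumes "A \<in> carrier_mat n m" "B \<in> carrier_mat m p" "i < n" "j < p"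
  shows "(A * B) $$ (i, j) = (\<Sum>k<m. A $$ (i, k) * B $$ (k, j))"
  using assms by (simp add: scalar_prod_def lessThan_atLeast0)

text \<open>The chain vectors form the columns of \<open>P\<close> and the coordinate functionals
  the rows of \<open>Q\<close>. Duality gives \<open>Q * P = 1\<close>, the expansion gives
  \<open>P * Q = 1\<close>, and shifting along chains gives \<open>A * P = P * J\<close>.\<close>

lemma jordan_nf_chains:
  fixes M :: "real ^ 'm::finite ^ 'm" and v :: "nat \<Rightarrow> real ^ 'm" and c :: "nat \<Rightarrow> nat \<Rightarrow> real ^ 'm \<Rightarrow> real"
  defines "T \<equiv> \<lambda>k a. (((*v) M) ^^ k) (v a)"
  assumes as: "distinct as" and d: "\<And>a. a \<in> set as \<Longrightarrow> 1 \<le> d a" and z: "\<And>a. a \<in> set as \<Longrightarrow> T (d a) a = 0"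
    and lin: "\<And>a i. linear (c a i)"
    and dual: "\<And>a b i j. a \<in> set as \<Longrightarrow> b \<in> set as \<Longrightarrow> i < d a \<Longrightarrow> j < d b \<Longrightarrow>
      c a i (T j b) = (if a = b \<and> i = j then 1 else 0)"
    and expand: "\<And>y. y = (\<Sum>a\<in>set as. \<Sum>i<d a. c a i y *\<^sub>R T i a)"
  shows "jordan_nf (to_mat M) (map (\<lambda>a. (d a, 0)) as)"
proof -
  define n where "n = CARD('m)"
  define L where "L = chain_index d as"
  define N where "N = length L"
  define e :: "nat \<Rightarrow> 'm" where "e = from_nat_into UNIV"
  have e: "bij_betw e {..<n} UNIV"
    unfolding e_def n_def by (rule bij_betw_from_nat_into_finite) simp
  have sume: "(\<Sum>i<n. f (e i)) = (\<Sum>x\<in>UNIV. f x)" for f :: "'m \<Rightarrow> real"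
    by (rule sum.reindex_bij_betw[OF e])
  have setL: "set L = (SIGMA a:set as. {..<d a})" unfolding L_def by (rule set_chain_index)
  have bijL: "bij_betw ((!) L) {..<N} (set L)"
    unfolding N_def L_def using distinct_chain_index[OF as] by (intro bij_betw_nth) auto
  have sumL: "(\<Sum>l<N. f (fst (L ! l)) (snd (L ! l))) = (\<Sum>a\<in>set as. \<Sum>i<d a. f a i)"
    for f :: "nat \<Rightarrow> nat \<Rightarrow> real"
  proof -
    have "(\<Sum>l<N. f (fst (L ! l)) (snd (L ! l))) = (\<Sum>p\<in>set L. f (fst p) (snd p))"
      using sum.reindex_bij_betw[OF bijL, of "\<lambda>p. f (fst p) (snd p)"] .
    also have "\<dots> = (\<Sum>a\<in>set as. \<Sum>i<d a. f a i)"
      unfolding setL by (subst sum.Sigma) (auto simp: case_prod_beta)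
    finally show ?thesis .
  qed
  have memL: "fst (L ! j) \<in> set as \<and> snd (L ! j) < d (fst (L ! j))" if "j < N" for j
  proof -
    have "L ! j \<in> set L" using that by (simp add: N_def)
    then show ?thesis unfolding setL by auto
  qed
  have injL: "L ! i = L ! j \<longleftrightarrow> i = j" if "i < N" "j < N" for i j
    using that distinct_chain_index[OF as, of d] by (simp add: N_def L_def nth_eq_iff_index_eq)
  define Pf where "Pf i j = vec_nth (T (snd (L ! j)) (fst (L ! j))) (e i)" for i j
  define Qf where "Qf j i = c (fst (L ! j)) (snd (L ! j)) (axis (e i) 1)" for i j
  have PQ: "(\<Sum>j<N. Pf i j * Qf j i') = (if i = i' then 1 else 0)" if "i < n" "i' < n" for i i'
  proof -
    have "(\<Sum>j<N. Pf i j * Qf j i') = (\<Sum>a\<in>set as. \<Sum>k<d a. vec_nth (T k a) (e i) * c a k (axis (e i') 1))"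
      unfolding Pf_def Qf_def by (rule sumL)
    also have "\<dots> = vec_nth (\<Sum>a\<in>set as. \<Sum>k<d a. c a k (axis (e i') 1) *\<^sub>R T k a) (e i)"
      by (simp add: sum_component mult.commute)
    also have "\<dots> = vec_nth (axis (e i') 1) (e i)" by (subst expand[symmetric]) (rule refl)
    also have "\<dots> = (if i = i' then 1 else 0)"
    proof -
      have "e i = e i' \<longleftrightarrow> i = i'" using e that by (auto simp: bij_betw_def inj_on_def)
      then show ?thesis by (simp add: axis_def)
    qed
    finally show ?thesis .
  qed
  have QP: "(\<Sum>i<n. Qf j i * Pf i j') = (if j = j' then 1 else 0)" if "j < N" "j' < N" for j j'
  proof -
    let ?c = "c (fst (L ! j)) (snd (L ! j))" and ?x = "T (snd (L ! j')) (fst (L ! j'))"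
    have "(\<Sum>i<n. Qf j i * Pf i j') = (\<Sum>x\<in>UNIV. ?c (axis x 1) * vec_nth ?x x)"
      unfolding Pf_def Qf_def by (rule sume)
    also have "\<dots> = ?c (\<Sum>x\<in>UNIV. vec_nth ?x x *\<^sub>R axis x 1)"
      by (simp add: linear_sum[OF lin] linear_scale[OF lin] mult.commute)
    also have "(\<Sum>x\<in>UNIV. vec_nth ?x x *\<^sub>R axis x 1) = ?x"
      using basis_expansion[of ?x] by (simp add: scalar_mult_eq_scaleR)
    also have "?c ?x = (if j = j' then 1 else 0)"
      using dual[of "fst (L ! j)" "fst (L ! j')"] memL[OF that(1)] memL[OF that(2)] injL[OF that]
      by (auto simp: prod_eq_iff)
    finally show ?thesis .
  qed
  \<comment> \<open>The traces of P Q and Q P agree; the first is the dimension and the second the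
    number of chain vectors, so both matrices are square.\<close>
  have "real n = (\<Sum>i<n. \<Sum>j<N. Pf i j * Qf j i)" using PQ by simp
  also have "\<dots> = (\<Sum>j<N. \<Sum>i<n. Qf j i * Pf i j)" by (subst sum.swap) (simp add: mult.commute)
  also have "\<dots> = real N" using QP by simp
  finally have nN: "n = N" by simp
  define A where "A = to_mat M"
  define P where "P = Matrix.mat n n (\<lambda>(i, j). Pf i j)"
  define Q where "Q = Matrix.mat n n (\<lambda>(j, i). Qf j i)"
  define J where "J = jordan_matrix (map (\<lambda>a. (d a, 0::real)) as)"
  have sl: "sum_list (map d as) = n" unfolding nN N_def L_def by (rule length_chain_index[symmetric])
  then have "sum_list (map fst (map (\<lambda>a. (d a, 0::real)) as)) = n" by (simp add: comp_def)
  then have Jc: "J \<in> carrier_mat n n"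
    unfolding J_def using jordan_matrix_carrier[of "map (\<lambda>a. (d a, 0::real)) as"] by simp
  have carr: "A \<in> carrier_mat n n" "P \<in> carrier_mat n n" "Q \<in> carrier_mat n n"
    by (simp_all add: A_def to_mat_def n_def P_def Q_def)
  have PQ1: "P * Q = 1\<^sub>m n"
  proof (rule eq_matI)
    fix i j assume "i < dim_row (1\<^sub>m n :: real Matrix.mat)" "j < dim_col (1\<^sub>m n :: real Matrix.mat)"
    then have ij: "i < n" "j < n" by simp_all
    show "(P * Q) $$ (i, j) = 1\<^sub>m n $$ (i, j)"
      using PQ[OF ij] ij unfolding index_mult_mat_sum[OF carr(2,3) ij] by (simp add: P_def Q_def nN)
  qed (use carr in auto)
  have QP1: "Q * P = 1\<^sub>m n"
  proof (rule eq_matI)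
    fix i j assume "i < dim_row (1\<^sub>m n :: real Matrix.mat)" "j < dim_col (1\<^sub>m n :: real Matrix.mat)"
    then have ij: "i < n" "j < n" by simp_all
    show "(Q * P) $$ (i, j) = 1\<^sub>m n $$ (i, j)"
      using QP[of i j] ij unfolding index_mult_mat_sum[OF carr(3,2) ij] by (simp add: P_def Q_def nN)
  qed (use carr in auto)
  have AP: "A * P = P * J"
  proof (rule eq_matI)
    fix i j assume "i < dim_row (P * J)" "j < dim_col (P * J)"
    then have ij: "i < n" "j < n" using carr Jc by auto
    define a where "a = fst (L ! j)"
    define k where "k = snd (L ! j)"
    have a: "a \<in> set as" "k < d a" using memL[of j] ij nN by (simp_all add: a_def k_def)
    have "(A * P) $$ (i, j) = (\<Sum>l<n. vec_nth (vec_nth M (e i)) (e l) * vec_nth (T k a) (e l))"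
      unfolding index_mult_mat_sum[OF carr(1,2) ij]
      using ij by (intro sum.cong refl) (simp add: A_def to_mat_def P_def Pf_def n_def e_def a_def k_def)
    also have "\<dots> = vec_nth (M *v T k a) (e i)"
      unfolding sume[of "\<lambda>x. vec_nth (vec_nth M (e i)) x * vec_nth (T k a) x"]
      by (simp add: matrix_vector_mult_def)
    also have "\<dots> = vec_nth (T (Suc k) a) (e i)" by (simp add: T_def)
    also have "\<dots> = (\<Sum>b\<in>set as. \<Sum>l<d b. vec_nth (T l b) (e i) * (if b = a \<and> l = Suc k then 1 else 0))"
    proof -
      have "(\<Sum>b\<in>set as. \<Sum>l<d b. vec_nth (T l b) (e i) * (if b = a \<and> l = Suc k then 1 else 0)) =
          (\<Sum>b\<in>set as. if b = a then vec_nth (T (Suc k) a) (e i) else 0)"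
      proof (intro sum.cong refl)
        fix b assume "b \<in> set as"
        have "Suc k = d a" if "\<not> Suc k < d a" using a(2) that by simp
        then show "(\<Sum>l<d b. vec_nth (T l b) (e i) * (if b = a \<and> l = Suc k then 1 else 0)) =
            (if b = a then vec_nth (T (Suc k) a) (e i) else 0)"
          using z[OF a(1)] by (cases "Suc k < d a") (auto simp: if_distrib cong: if_cong)
      qed
      then show ?thesis using a(1) by simp
    qed
    also have "\<dots> = (\<Sum>l<N. vec_nth (T (snd (L ! l)) (fst (L ! l))) (e i) *
        (if fst (L ! l) = a \<and> snd (L ! l) = Suc k then 1 else 0))"
      by (rule sumL[symmetric])
    also have "\<dots> = (P * J) $$ (i, j)"
      unfolding index_mult_mat_sum[OF carr(2) Jc ij] nN[symmetric]
      using ij by (intro sum.cong refl)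
        (simp add: J_def jordan_matrix_chain_index[OF as] sl P_def Pf_def a_def k_def L_def)
    finally show "(A * P) $$ (i, j) = (P * J) $$ (i, j)" .
  qed (use carr Jc in auto)
  have "A = A * (P * Q)" using carr by (simp add: PQ1)
  also have "\<dots> = P * J * Q" using carr AP by (simp flip: assoc_mult_mat)
  finally have "similar_mat A J" using carr Jc PQ1 QP1 by (intro similar_matI[of _ _ P Q n]) auto
  moreover have "0 \<notin> fst ` set (map (\<lambda>a. (d a, 0::real)) as)" using d by force
  ultimately show ?thesis unfolding jordan_nf_def A_def J_def by blast
qed

lemma count_jordan_partition_chains:
  fixes om :: "real ^ 'm::finite \<Rightarrow> real ^ 'm \<Rightarrow> real"
  assumes "symplectic_chains om ((*v) M) I v d eps st"
  shows "count (jordan_partition M) \<eta> = card {a \<in> I. d a = \<eta>}"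
proof -
  interpret symplectic_chains om "(*v) M" I v d eps st by fact
  define as where "as = sorted_list_of_set I"
  have as: "distinct as" "set as = I" using finite_I by (simp_all add: as_def)
  have "linear (coord a i)" for a i
    by (rule linearI) (simp_all add: coord_add coord_scale)
  then have "jordan_nf (to_mat M) (map (\<lambda>a. (d a, 0)) as)"
    using d_pos pow_d coord_chain expansion as
    by (intro jordan_nf_chains[where c = coord and v = v]) simp_all
  from jordan_partition_eqI[OF this] have "jordan_partition M = mset (map d as)"
    by (simp add: comp_def)
  then have "count (jordan_partition M) \<eta> = count_list (map d as) \<eta>"
    by (simp only: count_mset)
  also have "\<dots> = length (filter (\<lambda>a. \<eta> = d a) as)"
    by (simp add: count_list_eq_length_filter filter_map comp_def)
  also have "\<dots> = card (set (filter (\<lambda>a. \<eta> = d a) as))"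
    using as(1) by (intro distinct_card[symmetric]) simp
  also have "set (filter (\<lambda>a. \<eta> = d a) as) = {a \<in> I. d a = \<eta>}" using as(2) by auto
  finally show ?thesis .
qed

section \<open>Symplectic matrices\<close>

lemma sum_UNIV_sum:
  fixes f :: "'a::finite + 'b::finite \<Rightarrow> 'c::comm_monoid_add"
  shows "(\<Sum>x\<in>UNIV. f x) = (\<Sum>a\<in>UNIV. f (Inl a)) + (\<Sum>b\<in>UNIV. f (Inr b))"
  unfolding UNIV_Plus_UNIV[symmetric] by (subst sum.Plus) auto

lemma sympJ_mult:
  "vec_nth (sympJ *v y) (Inl a) = - vec_nth y (Inr a)"
  "vec_nth (sympJ *v y) (Inr a) = vec_nth y (Inl a)"
  by (simp_all add: matrix_vector_mult_def sympJ_def sum_UNIV_sum if_distrib if_distribR cong: if_cong)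

lemma symp_form_eq:
  "symp_form x y = (\<Sum>a\<in>UNIV. vec_nth x (Inr a) * vec_nth y (Inl a)) -
    (\<Sum>a\<in>UNIV. vec_nth x (Inl a) * vec_nth y (Inr a))"
  by (simp add: symp_form_def inner_vec_def sum_UNIV_sum sympJ_mult sum_negf)

lemma symp_form_swap: "symp_form x y = - symp_form y x"
  by (simp add: symp_form_eq mult.commute)

lemma bilinear_symp_form: "bilinear symp_form"
  unfolding bilinear_def
  by (auto intro!: linearI simp: symp_form_def matrix_vector_right_distrib inner_add_right inner_add_left
      matrix_vector_mult_scaleR)

lemma sympJ_sympJ: "sympJ *v (sympJ *v y) = - y"
proof (rule vec_eq_iff[THEN iffD2], rule allI)
  fix i :: "'a + 'a"
  show "vec_nth (sympJ *v (sympJ *v y)) i = vec_nth (- y) i" by (cases i) (simp_all add: sympJ_mult)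
qed

lemma symp_form_nondegenerate:
  assumes "\<And>y. symp_form x y = 0"
  shows "x = 0"
proof -
  have "inner x x = 0" using assms[of "sympJ *v x"] by (simp add: symp_form_def sympJ_sympJ)
  then show ?thesis by simp
qed

lemma inner_transpose_mult:
  fixes A :: "real ^ 'n ^ 'm"
  shows "inner x (Finite_Cartesian_Product.transpose A *v y) = inner (A *v x) y"
  by (metis dot_lmul_matrix inner_commute transpose_matrix_vector)

lemma matrix_eqI_inner:
  fixes A B :: "real ^ 'n ^ 'm"
  assumes "\<And>x y. inner x (A *v y) = inner x (B *v y)"
  shows "A = B"
proof -
  have "A *v y = B *v y" for y using assms vector_eq_rdot by (metis inner_commute)
  then show ?thesis by (simp add: matrix_eq)
qed

section \<open>Membership in the group and its Lie algebra through the form, and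
  determinants\<close>

lemma sp_iff:
  "z \<in> sp \<longleftrightarrow> Determinants.trace z = 0 \<and> (\<forall>x y. symp_form (z *v x) y = - symp_form x (z *v y))"
proof -
  have e: "inner x ((Finite_Cartesian_Product.transpose z ** sympJ + sympJ ** z) *v y) =
      symp_form (z *v x) y + symp_form x (z *v y)" for x y
    by (simp add: symp_form_def matrix_vector_mult_add_rdistrib inner_add_right inner_transpose_mult
        del: transpose_matrix_vector flip: matrix_vector_mul_assoc)
  have "(Finite_Cartesian_Product.transpose z ** sympJ + sympJ ** z = 0) \<longleftrightarrow>
      (\<forall>x y. symp_form (z *v x) y + symp_form x (z *v y) = 0)"
    unfolding e[symmetric] using matrix_eqI_inner[of _ 0] by (auto simp: matrix_vector_mult_0)
  then show ?thesis unfolding sp_def by (simp add: eq_neg_iff_add_eq_0)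
qed

lemma Sp_iff:
  "g \<in> Sp \<longleftrightarrow> Determinants.det g = 1 \<and> (\<forall>x y. symp_form (g *v x) (g *v y) = symp_form x y)"
proof -
  have e: "inner x ((Finite_Cartesian_Product.transpose g ** sympJ ** g) *v y) = symp_form (g *v x) (g *v y)" for x y
    by (simp add: symp_form_def inner_transpose_mult del: transpose_matrix_vector
        flip: matrix_vector_mul_assoc)
  have "(Finite_Cartesian_Product.transpose g ** sympJ ** g = sympJ) \<longleftrightarrow>
      (\<forall>x y. symp_form (g *v x) (g *v y) = symp_form x y)"
  proof
    assume "Finite_Cartesian_Product.transpose g ** sympJ ** g = sympJ"
    then show "\<forall>x y. symp_form (g *v x) (g *v y) = symp_form x y"
      using e by (simp add: symp_form_def)
  next
    assume "\<forall>x y. symp_form (g *v x) (g *v y) = symp_form x y"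
    then show "Finite_Cartesian_Product.transpose g ** sympJ ** g = sympJ"
      by (intro matrix_eqI_inner) (simp only: e symp_form_def)
  qed
  then show ?thesis unfolding Sp_def by simp
qed

text \<open>Along the segment from the identity to \<open>A\<close> one has
  \<open>inner x (F s *v x) = (1 - s) * inner x x\<close>, so \<open>F s\<close> is invertible for s
  < 1. The determinant starts at 1 and cannot cross zero before the endpoint.\<close>

lemma det_alternating_nonneg:
  fixes A :: "real ^ 'n ^ 'n"
  assumes A: "\<And>x. inner x (A *v x) = 0"
  shows "Determinants.det A \<ge> 0"
proof (rule ccontr)
  define F where "F s = (1 - s) *\<^sub>R Finite_Cartesian_Product.mat 1 + s *\<^sub>R A" for s :: real
  assume "\<not> ?thesis"
  then have neg: "Determinants.det (F 1) < 0" by (simp add: F_def)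
  have "continuous_on {0..1} (\<lambda>s. Determinants.det (F s))"
    unfolding det_def F_def by (simp, intro continuous_intros)
  moreover have "Determinants.det (F 0) = 1" by (simp add: F_def)
  ultimately obtain s where s: "0 \<le> s" "s \<le> 1" "Determinants.det (F s) = 0"
    using IVT2'[of "\<lambda>s. Determinants.det (F s)" 1 0 0] neg by auto
  then have "s < 1" using neg by (cases "s = 1") auto
  have "\<not> invertible (F s)" using s(3) by (simp add: invertible_det_nz)
  then obtain x where x: "F s *v x = 0" "x \<noteq> 0"
    by (metis invertible_left_inverse matrix_left_invertible_ker)
  have "inner x (F s *v x) = (1 - s) * inner x x"
    using A[of x] by (simp add: F_def matrix_vector_mult_add_rdistrib inner_add_right scaleR_matrix_vector_assoc[symmetric])
  then show False using x \<open>s < 1\<close> by simp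
qed

lemma uminus_matrix_vector_mult:
  fixes A :: "real ^ 'n ^ 'm"
  shows "(- A) *v x = - (A *v x)"
  by (simp add: matrix_vector_mult_def vec_eq_iff sum_negf)

lemma det_symplectic_involution:
  fixes \<tau> :: "real ^ ('n::finite + 'n) ^ ('n + 'n)"
  assumes inv: "\<tau> ** \<tau> = Finite_Cartesian_Product.mat 1"
    and iso: "\<And>x y. symp_form (\<tau> *v x) (\<tau> *v y) = symp_form x y"
  shows "Determinants.det \<tau> = 1"
proof -
  let ?J = "sympJ :: real ^ ('n + 'n) ^ ('n + 'n)"
  have z: "symp_form x x = 0" for x :: "real ^ ('n + 'n)" using symp_form_swap[of x x] by simp
  \<comment> \<open>The same criterion settles the sign for \<open>sympJ\<close> itself, and
    \<open>sympJ^2 = -1\<close> excludes zero.\<close>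
  have "Determinants.det ?J \<ge> 0"
    using z by (intro det_alternating_nonneg) (simp add: symp_form_def)
  moreover have "Determinants.det ?J \<noteq> 0"
  proof -
    have "?J ** (- ?J) = Finite_Cartesian_Product.mat 1"
      unfolding matrix_eq
      by (simp add: uminus_matrix_vector_mult linear_neg[OF matrix_vector_mul_linear] sympJ_sympJ
          flip: matrix_vector_mul_assoc)
    then have "Determinants.det ?J * Determinants.det (- ?J) = 1" by (metis det_I det_mul)
    then show ?thesis by auto
  qed
  ultimately have J: "Determinants.det ?J > 0" by simp
  \<comment> \<open>Isometry and involution make this value equal to
    \<open>symp_form (\<tau> *v x) x\<close>, while alternation makes it the negative of
    that.\<close>
  have "symp_form x (\<tau> *v x) = 0" for x
  proof -
    have "symp_form x (\<tau> *v x) = symp_form (\<tau> *v x) (\<tau> *v (\<tau> *v x))" by (rule iso[symmetric])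
    also have "\<tau> *v (\<tau> *v x) = x" by (simp add: matrix_vector_mul_assoc inv)
    finally show ?thesis using symp_form_swap[of x "\<tau> *v x"] by simp
  qed
  then have "Determinants.det (?J ** \<tau>) \<ge> 0"
    by (intro det_alternating_nonneg) (simp add: symp_form_def flip: matrix_vector_mul_assoc)
  then have "Determinants.det \<tau> \<ge> 0" using J by (simp add: det_mul zero_le_mult_iff)
  moreover have "Determinants.det \<tau> * Determinants.det \<tau> = 1" by (metis inv det_I det_mul)
  ultimately show ?thesis by (metis abs_of_nonneg abs_mult_self_eq power2_eq_1_iff power2_eq_square abs_minus_cancel abs_1)
qed

lemma Ad_eq_minus_iff:
  fixes g X :: "real ^ 'm ^ 'm"
  assumes "invertible g"
  shows "- X = Ad g X \<longleftrightarrow> (\<forall>x. g *v (X *v x) = - (X *v (g *v x)))"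
proof -
  have "\<exists>h. g ** h = Finite_Cartesian_Product.mat 1 \<and> h ** g = Finite_Cartesian_Product.mat 1"
    using assms by (auto simp: invertible_def)
  then have inv: "g ** matrix_inv g = Finite_Cartesian_Product.mat 1"
      "matrix_inv g ** g = Finite_Cartesian_Product.mat 1"
    unfolding matrix_inv_def by (metis (mono_tags, lifting) someI_ex)+
  have "- X = Ad g X \<longleftrightarrow> (- X) ** g = g ** X"
  proof
    assume "- X = Ad g X"
    then have "(- X) ** g = g ** X ** (matrix_inv g ** g)" by (simp add: Ad_def matrix_mul_assoc)
    then show "(- X) ** g = g ** X" by (simp add: inv)
  next
    assume "(- X) ** g = g ** X"
    then have "Ad g X = (- X) ** (g ** matrix_inv g)" by (simp add: Ad_def matrix_mul_assoc)
    then show "- X = Ad g X" by (simp add: inv)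
  qed
  also have "\<dots> \<longleftrightarrow> (\<forall>x. g *v (X *v x) = - (X *v (g *v x)))"
    unfolding matrix_eq
    by (auto simp: uminus_matrix_vector_mult eq_commute simp flip: matrix_vector_mul_assoc)
  finally show ?thesis .
qed

section \<open>Passage from matrices to linear maps\<close>

lemma symplectic_map_sp:
  assumes "X \<in> sp"
  shows "symplectic_map symp_form ((*v) X)"
proof (rule symplectic_map.intro)
  show "symp_form (X *v x) y = - symp_form x (X *v y)" for x y
    using assms by (simp add: sp_iff)
qed (rule bilinear_symp_form symp_form_swap matrix_vector_mul_linear)+

lemma funpow_matrix:
  fixes X :: "real ^ 'm ^ 'm"
  shows "(((**) X) ^^ k) (Finite_Cartesian_Product.mat 1) *v x = (((*v) X) ^^ k) x"
  by (induction k) (simp_all flip: matrix_vector_mul_assoc)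

lemma nilpotent_matrixE:
  assumes "nilpotent_matrix X"
  obtains n where "\<And>x. (((*v) X) ^^ n) x = 0"
proof -
  obtain n where "(((**) X) ^^ n) (Finite_Cartesian_Product.mat 1) = 0"
    using assms unfolding nilpotent_matrix_def by blast
  then have "(((*v) X) ^^ n) x = 0" for x using funpow_matrix[of n X x] by simp
  then show thesis by (rule that)
qed

lemma symplectic_sl2_triple:
  assumes "sl2_triple_in sp X H Y" and "\<And>x. (((*v) X) ^^ n) x = 0"
  shows "symplectic_sl2 symp_form ((*v) X) ((*v) H) ((*v) Y) n"
proof -
  have X: "X \<in> sp" and b: "H ** X - X ** H = 2 *\<^sub>R X" "H ** Y - Y ** H = - 2 *\<^sub>R Y" "X ** Y - Y ** X = H"
    using assms(1) by (simp_all add: sl2_triple_in_def lie_bracket_def)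
  have c: "A *v (B *v x) - B *v (A *v x) = C *v x" if "A ** B - B ** A = C" for A B C :: "real^('a+'a)^('a+'a)" and x
    unfolding that[symmetric] by (simp add: matrix_vector_mult_diff_rdistrib matrix_vector_mul_assoc)
  show ?thesis
  proof (intro symplectic_sl2.intro sl2_rep.intro symplectic_sl2_axioms.intro)
    show "symplectic_map symp_form ((*v) X)" by (rule symplectic_map_sp[OF X])
    show "(((*v) X) ^^ n) x = 0" for x by (rule assms(2))
    show "H *v (X *v w) = X *v (H *v w) + 2 *\<^sub>R (X *v w)" for w
      using c[OF b(1), of w] by (simp add: scaleR_matrix_vector_assoc[symmetric] diff_eq_eq add.commute)
    show "H *v (Y *v w) = Y *v (H *v w) - 2 *\<^sub>R (Y *v w)" for w
      using c[OF b(2), of w]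
      by (simp add: scaleR_matrix_vector_assoc[symmetric] uminus_matrix_vector_mult diff_eq_eq)
    show "X *v (Y *v w) = Y *v (X *v w) + H *v w" for w
      using c[OF b(3), of w] by (simp add: diff_eq_eq add.commute)
  qed (rule matrix_vector_mul_linear)+
qed

lemma submodule_of_iff:
  assumes "sl2_rep ((*v) X) ((*v) H) ((*v) Y)"
  shows "submodule_of (Real_Vector_Spaces.span {X, H, Y}) W \<longleftrightarrow>
    sl2_rep.submodule ((*v) X) ((*v) H) ((*v) Y) W"
proof -
  interpret sl2_rep "(*v) X" "(*v) H" "(*v) Y" by fact
  have "Z *v w \<in> W" if W: "Real_Vector_Spaces.subspace W" and "X *v w \<in> W" "H *v w \<in> W" "Y *v w \<in> W"
    and Z: "Z \<in> Real_Vector_Spaces.span {X, H, Y}" for Z w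
  proof -
    have "Real_Vector_Spaces.subspace {Z. Z *v w \<in> W}"
      using W by (auto simp: subspace_def matrix_vector_mult_add_rdistrib scaleR_matrix_vector_assoc[symmetric])
    then have "Real_Vector_Spaces.span {X, H, Y} \<subseteq> {Z. Z *v w \<in> W}"
      using that(2-4) by (intro span_minimal) auto
    then show ?thesis using Z by blast
  qed
  moreover have "{X, H, Y} \<subseteq> Real_Vector_Spaces.span {X, H, Y}" by (rule span_superset)
  ultimately show ?thesis unfolding submodule_of_def submodule_def by blast
qed

lemma lowest_eq_lowest_weight:
  assumes rep: "sl2_rep ((*v) X) ((*v) H) ((*v) Y)" and nil: "\<And>x. (((*v) X) ^^ n) x = 0" and "1 \<le> d"
  shows "lowest X H Y d = sl2_rep.lowest_weight ((*v) H) ((*v) Y) d"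
proof -
  interpret sl2_rep "(*v) X" "(*v) H" "(*v) Y" by fact
  have "irreducible_submodule (Real_Vector_Spaces.span {X, H, Y}) W \<longleftrightarrow> irreducible W" for W
    unfolding irreducible_submodule_def irreducible_def submodule_of_iff[OF rep] ..
  then show ?thesis
    unfolding lowest_def isotypic_def using lowest_weight_eq[OF nil assms(3)] by simp
qed

lemma adapted_basis_iff:
  assumes "sl2_triple_in sp X H Y" and nil: "\<And>x. (((*v) X) ^^ n) x = 0" and "1 \<le> d"
  shows "adapted_basis X H Y d B \<longleftrightarrow>
    symplectic_sl2.signed_basis symp_form ((*v) X) ((*v) H) ((*v) Y) d B"
proof -
  interpret symplectic_sl2 symp_form "(*v) X" "(*v) H" "(*v) Y" n
    by (rule symplectic_sl2_triple[OF assms(1,2)])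
  have "twisted_form X d v w = top_form d v w" for v w
    by (simp add: twisted_form_def top_form_def)
  then show ?thesis
    unfolding adapted_basis_def signed_basis_def
      lowest_eq_lowest_weight[OF sl2_rep_axioms nil assms(3)] by simp
qed

lemma symplectic_chains_exist:
  assumes X: "X \<in> sp" and nil: "nilpotent_matrix X"
  obtains I v d eps st where "symplectic_chains symp_form ((*v) X) I v d eps st"
proof -
  interpret symplectic_map symp_form "(*v) X" by (rule symplectic_map_sp[OF X])
  obtain n where n: "\<And>x. (((*v) X) ^^ n) x = 0" using nilpotent_matrixE[OF nil] by blast
  have "\<exists>I v d eps st. chain_family UNIV I v d eps st \<and> I \<subseteq> {0..}"
  proof (rule exists_chain_family[OF n])
    show "x = 0" if "\<And>y. y \<in> UNIV \<Longrightarrow> symp_form x y = 0" for x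
      using that by (intro symp_form_nondegenerate) simp
  qed simp_all
  then obtain I v d eps st where "chain_family UNIV I v d eps st" by (elim exE conjE)
  then have "symplectic_chains symp_form ((*v) X) I v d eps st"
    by (intro symplectic_chains.intro symplectic_chains_axioms.intro symplectic_map_axioms)
  then show thesis by (rule that)
qed

lemma trace_scaleR: "Determinants.trace (c *\<^sub>R (A :: real ^ 'n ^ 'n)) = c * Determinants.trace A"
  by (simp add: trace_def sum_distrib_left)

lemma sl2_triple_chains:
  fixes X :: "real ^ ('n::finite + 'n) ^ ('n + 'n)"
  assumes X: "X \<in> sp" "X \<noteq> 0" and "symplectic_chains symp_form ((*v) X) I v d eps st"
  obtains H Y where "sl2_triple_in sp X H Y"
    "(*v) H = symplectic_chains.H symp_form ((*v) X) I v d eps st"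
    "(*v) Y = symplectic_chains.Y symp_form ((*v) X) I v d eps st"
proof -
  interpret symplectic_chains symp_form "(*v) X" I v d eps st by fact
  define Hm where "Hm = matrix H"
  define Ym where "Ym = matrix Y"
  have H: "(*v) Hm = H" unfolding Hm_def by (rule matrix_vector_mul(2)[OF linear_H])
  have Y: "(*v) Ym = Y" unfolding Ym_def by (rule matrix_vector_mul(2)[OF linear_Y])
  note mv = matrix_eq matrix_vector_mult_diff_rdistrib matrix_vector_mul_assoc[symmetric]
    scaleR_matrix_vector_assoc[symmetric] H Y
  have HX: "Hm ** X - X ** Hm = 2 *\<^sub>R X" unfolding mv H_X by simp
  have HY: "Hm ** Ym - Ym ** Hm = - 2 *\<^sub>R Ym" unfolding mv H_Y by simp
  have XY: "X ** Ym - Ym ** X = Hm" unfolding mv X_Y by simp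
  \<comment> \<open>The trace condition in \<open>sp\<close> holds because both matrices are
    commutators up to a scalar: H = [X, Y] and -2 Y = [H, Y].\<close>
  have "Determinants.trace Hm = 0"
    using trace_sub[of "X ** Ym" "Ym ** X"] trace_mul_sym[of X Ym] unfolding XY by simp
  moreover have "Determinants.trace (- 2 *\<^sub>R Ym) = 0"
    using trace_sub[of "Hm ** Ym" "Ym ** Hm"] trace_mul_sym[of Hm Ym] unfolding HY by simp
  then have "Determinants.trace Ym = 0" unfolding trace_scaleR by simp
  ultimately have "Hm \<in> sp" "Ym \<in> sp"
    unfolding sp_iff using om_H om_Y by (simp_all add: H Y)
  then have "sl2_triple_in sp X Hm Ym"
    unfolding sl2_triple_in_def lie_bracket_def using X HX HY XY by simp
  then show thesis using H Y by (rule that)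
qed

lemma even_part_iff:
  assumes "symplectic_chains symp_form ((*v) X) I v d eps st"
  shows "\<eta> \<in> even_parts X \<longleftrightarrow> even \<eta> \<and> (\<exists>a\<in>I. d a = \<eta>)"
proof -
  interpret symplectic_chains symp_form "(*v) X" I v d eps st by fact
  have "\<eta> \<in># jordan_partition X \<longleftrightarrow> card {a \<in> I. d a = \<eta>} \<noteq> 0"
    unfolding count_jordan_partition_chains[OF assms, symmetric] by simp
  also have "\<dots> \<longleftrightarrow> (\<exists>a\<in>I. d a = \<eta>)" using finite_I by auto
  finally show ?thesis unfolding even_parts_def by auto
qed

text \<open>Discharges the definite description: inertia makes every other triple and adapted basis
  yield the same count.\<close>

lemma p_sign_eq:
  assumes "sl2_triple_in sp X H Y" and nil: "\<And>x. (((*v) X) ^^ n) x = 0" and d: "even d" "1 \<le> d"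
    and B: "adapted_basis X H Y d B"
  shows "p_sign X d = card {v \<in> B. twisted_form X d v v = 1}"
  unfolding p_sign_def
proof (rule the_equality)
  show "\<exists>H' Y' B'. sl2_triple_in sp X H' Y' \<and> adapted_basis X H' Y' d B' \<and>
      card {v \<in> B. twisted_form X d v v = 1} = card {v \<in> B'. twisted_form X d v v = 1}"
    using assms by blast
  fix p assume "\<exists>H' Y' B'. sl2_triple_in sp X H' Y' \<and> adapted_basis X H' Y' d B' \<and>
      p = card {v \<in> B'. twisted_form X d v v = 1}"
  then obtain H' Y' B' where T': "sl2_triple_in sp X H' Y'" and B': "adapted_basis X H' Y' d B'"
    and p: "p = card {v \<in> B'. twisted_form X d v v = 1}" by blast
  note S = symplectic_sl2_triple[OF assms(1) nil] and S' = symplectic_sl2_triple[OF T' nil]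
  interpret symplectic_sl2 symp_form "(*v) X" "(*v) H" "(*v) Y" n by (rule S)
  have tf: "twisted_form X d v w = top_form d v w" for v w
    by (simp add: twisted_form_def top_form_def)
  show "p = card {v \<in> B. twisted_form X d v v = 1}"
    unfolding p tf
    using B B' unfolding adapted_basis_iff[OF assms(1) nil d(2)] adapted_basis_iff[OF T' nil d(2)]
    by (intro signed_basis_positive_unique[OF S' S _ _ d])
qed

text \<open>The chains provide a triple and an adapted basis, hence the existence part of \<open>p_sign\<close>.\<close>

lemma adapted_basis_chains:
  fixes X :: "real ^ ('n::finite + 'n) ^ ('n + 'n)"
  assumes X: "X \<in> sp" and nil: "nilpotent_matrix X"
    and ch: "symplectic_chains symp_form ((*v) X) I v d eps st" and \<eta>: "\<eta> \<in> even_parts X"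
  obtains H Y where "sl2_triple_in sp X H Y" "adapted_basis X H Y \<eta> (v ` {a \<in> I. d a = \<eta>})"
    "\<And>s. card {b \<in> v ` {a \<in> I. d a = \<eta>}. twisted_form X \<eta> b b = s} = card {a \<in> I. d a = \<eta> \<and> eps a = s}"
proof -
  interpret symplectic_chains symp_form "(*v) X" I v d eps st by (rule ch)
  obtain a where a: "a \<in> I" "d a = \<eta>" and ev: "even \<eta>" using \<eta> even_part_iff[OF ch] by blast
  have \<eta>1: "1 \<le> \<eta>" using d_pos[OF a(1)] a(2) by simp
  \<comment> \<open>A triple requires a nonzero \<open>X\<close>. As \<eta> is even, \<eta> - 1 is
    at least 1, so for X = 0 the top form would vanish, although its value on \<open>v a\<close> is
    1 or -1.\<close>
  have "X \<noteq> 0"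
  proof
    assume "X = 0"
    moreover have "\<eta> - 1 = Suc (\<eta> - 2)" using ev \<eta>1 by presburger
    ultimately have "((*v) X ^^ (\<eta> - 1)) (v a) = 0" by (simp add: matrix_vector_mult_0)
    then have "top_form \<eta> (v a) (v a) = 0" by (simp add: top_form_def om_simps)
    then show False using top_form_v[OF a(1) a(1)] eps[OF a(1)] ev a(2) by auto
  qed
  then obtain H' Y' where T: "sl2_triple_in sp X H' Y'" and HY: "(*v) H' = H" "(*v) Y' = Y"
    using sl2_triple_chains[OF X _ ch] by blast
  obtain n where n: "\<And>x. (((*v) X) ^^ n) x = 0" using nilpotent_matrixE[OF nil] by blast
  have tf: "twisted_form X \<eta> x y = top_form \<eta> x y" for x y
    by (simp add: twisted_form_def top_form_def)
  let ?B = "v ` {a \<in> I. d a = \<eta>}"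
  have form: "twisted_form X \<eta> (v b) (v c) = (if b = c then eps b else 0)"
    if "b \<in> I" "c \<in> I" "d b = \<eta>" for b c
    using top_form_v[OF that(1,2)] that(3) ev by (simp add: tf)
  have "lowest X H' Y' \<eta> = lowest_weight \<eta>"
  proof -
    have rep: "sl2_rep ((*v) X) ((*v) H') ((*v) Y')" unfolding HY by (rule sl2_rep_axioms)
    show ?thesis using lowest_eq_lowest_weight[OF rep n \<eta>1] unfolding HY .
  qed
  then have sp: "Real_Vector_Spaces.span ?B = lowest X H' Y' \<eta>" using lowest_weight_chain by simp
  have orth: "twisted_form X \<eta> x y = 0" if "x \<in> ?B" "y \<in> ?B" "x \<noteq> y" for x y
    using that form by auto
  have pm: "twisted_form X \<eta> x x = 1 \<or> twisted_form X \<eta> x x = - 1" if x: "x \<in> ?B" for x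
  proof -
    obtain b where "b \<in> I" "d b = \<eta>" "x = v b" using x by blast
    then show ?thesis using form[of b b] eps[of b] by simp
  qed
  have AB: "adapted_basis X H' Y' \<eta> ?B"
    unfolding adapted_basis_def by (intro conjI ballI impI independent_v sp orth pm)
  have cards: "card {b \<in> ?B. twisted_form X \<eta> b b = s} = card {a \<in> I. d a = \<eta> \<and> eps a = s}" for s
  proof -
    have "{b \<in> ?B. twisted_form X \<eta> b b = s} = v ` {a \<in> I. d a = \<eta> \<and> eps a = s}"
      using form by auto
    moreover have "inj_on v {a \<in> I. d a = \<eta> \<and> eps a = s}" using inj_v by (rule inj_on_subset) auto
    ultimately show ?thesis by (simp add: card_image)
  qed
  show thesis using T AB cards by (rule that)
qed

section \<open>Reality in terms of the signs of chains\<close>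

lemma card_sign_split:
  assumes "symplectic_chains symp_form ((*v) X) I v d eps st"
  shows "count (jordan_partition X) \<eta> =
    card {a \<in> I. d a = \<eta> \<and> eps a = 1} + card {a \<in> I. d a = \<eta> \<and> eps a = - 1}"
proof -
  interpret symplectic_chains symp_form "(*v) X" I v d eps st by fact
  have "{a \<in> I. d a = \<eta>} = {a \<in> I. d a = \<eta> \<and> eps a = 1} \<union> {a \<in> I. d a = \<eta> \<and> eps a = - 1}"
    using eps by auto
  moreover have "card ({a \<in> I. d a = \<eta> \<and> eps a = 1} \<union> {a \<in> I. d a = \<eta> \<and> eps a = - 1}) =
      card {a \<in> I. d a = \<eta> \<and> eps a = 1} + card {a \<in> I. d a = \<eta> \<and> eps a = - 1}"
    using finite_I by (intro card_Un_disjoint) auto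
  ultimately show ?thesis unfolding count_jordan_partition_chains[OF assms] by simp
qed

lemma Sp_invertible: "g \<in> Sp \<Longrightarrow> invertible g"
  by (simp add: Sp_def invertible_det_nz)

lemma real_imp_balanced:
  fixes X :: "real ^ ('n::finite + 'n) ^ ('n + 'n)"
  assumes X: "X \<in> sp" and nil: "nilpotent_matrix X" and real: "Ad_real Sp X"
    and ch: "symplectic_chains symp_form ((*v) X) I v d eps st" and \<eta>: "\<eta> \<in> even_parts X"
  shows "card {a \<in> I. d a = \<eta> \<and> eps a = 1} = card {a \<in> I. d a = \<eta> \<and> eps a = - 1}"
proof -
  obtain g where g: "g \<in> Sp" "- X = Ad g X" using real unfolding Ad_real_def by blast
  obtain n where n: "\<And>x. (((*v) X) ^^ n) x = 0" using nilpotent_matrixE[OF nil] by blast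
  obtain H Y where T: "sl2_triple_in sp X H Y" and B: "adapted_basis X H Y \<eta> (v ` {a \<in> I. d a = \<eta>})"
    and cards: "\<And>s. card {b \<in> v ` {a \<in> I. d a = \<eta>}. twisted_form X \<eta> b b = s} =
      card {a \<in> I. d a = \<eta> \<and> eps a = s}"
    by (rule adapted_basis_chains[OF X nil ch \<eta>]) (rule that)
  have ev: "even \<eta>" "1 \<le> \<eta>"
    using \<eta> unfolding even_part_iff[OF ch] using symplectic_chains.d_pos[OF ch] by auto
  interpret symplectic_sl2 symp_form "(*v) X" "(*v) H" "(*v) Y" n
    by (rule symplectic_sl2_triple[OF T n])
  have tf: "twisted_form X \<eta> x y = top_form \<eta> x y" for x y
    by (simp add: twisted_form_def top_form_def)
  have B': "signed_basis \<eta> (v ` {a \<in> I. d a = \<eta>})"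
    using B unfolding adapted_basis_iff[OF T n ev(2)] .
  have inj: "inj ((*v) g)"
    using Sp_invertible[OF g(1)] by (simp add: inj_matrix_vector_mult)
  have anti: "g *v (X *v x) = - (X *v (g *v x))" for x
    using g(2) Ad_eq_minus_iff[OF Sp_invertible[OF g(1)]] by blast
  have iso: "symp_form (g *v x) (g *v y) = symp_form x y" for x y
    using g(1) by (simp add: Sp_iff)
  show ?thesis
    unfolding cards[symmetric] tf
    by (rule anticommuting_isometry_balanced[OF B' ev matrix_vector_mul_linear iso anti inj])
qed

lemma balanced_imp_strongly_real:
  fixes X :: "real ^ ('n::finite + 'n) ^ ('n + 'n)"
  assumes ch: "symplectic_chains symp_form ((*v) X) I v d eps st"
    and bal: "\<And>\<eta>. even \<eta> \<Longrightarrow> card {a \<in> I. d a = \<eta> \<and> eps a = 1} = card {a \<in> I. d a = \<eta> \<and> eps a = - 1}"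
  shows "strongly_Ad_real Sp X"
proof -
  interpret symplectic_chains symp_form "(*v) X" I v d eps st by (rule ch)
  obtain t where t: "linear t" "\<And>y. t (t y) = y" "\<And>y. t (X *v y) = - (X *v t y)"
    "\<And>x y. symp_form (t x) (t y) = symp_form x y"
  proof (rule sign_exchange[OF bal])
    fix \<pi> assume "\<And>a. a \<in> I \<Longrightarrow> \<pi> a \<in> I" "\<And>a. a \<in> I \<Longrightarrow> \<pi> (\<pi> a) = a" "\<And>a. a \<in> I \<Longrightarrow> d (\<pi> a) = d a"
      "\<And>a. a \<in> I \<Longrightarrow> st (\<pi> a) = \<pi> (st a)" "\<And>a. a \<in> I \<Longrightarrow> eps (\<pi> a) = (-1) ^ (d a - 1) * eps a"
    note pi = this
    show thesis by (rule anticommuting_involution[OF pi]) (assumption | rule that)+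
  qed
  define \<tau> where "\<tau> = matrix t"
  have \<tau>: "(*v) \<tau> = t" unfolding \<tau>_def by (rule matrix_vector_mul(2)[OF t(1)])
  have inv: "\<tau> ** \<tau> = Finite_Cartesian_Product.mat 1"
    unfolding matrix_eq by (simp add: \<tau> t(2) flip: matrix_vector_mul_assoc)
  have iso: "symp_form (\<tau> *v x) (\<tau> *v y) = symp_form x y" for x y by (simp add: \<tau> t(4))
  have "\<tau> \<in> Sp" unfolding Sp_iff using det_symplectic_involution[OF inv iso] iso by simp
  moreover have "- X = Ad \<tau> X"
    unfolding Ad_eq_minus_iff[OF Sp_invertible[OF \<open>\<tau> \<in> Sp\<close>]] by (simp add: \<tau> t(3))
  ultimately show ?thesis unfolding strongly_Ad_real_def using inv by blast
qed

theorem theorem5p8: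
  fixes X :: "real ^ ('n::finite + 'n) ^ ('n + 'n)"
  assumes "X \<in> sp" and "nilpotent_matrix X"
  shows "(Ad_real Sp X \<longleftrightarrow> strongly_Ad_real Sp X) \<and>
         (strongly_Ad_real Sp X \<longleftrightarrow>
            (\<forall>\<eta>\<in>even_parts X.
               real (p_sign X \<eta>) = real (count (jordan_partition X) \<eta>) / 2 \<and>
               real (q_sign X \<eta>) = real (count (jordan_partition X) \<eta>) / 2))"
proof -
  obtain I v d eps st where ch: "symplectic_chains symp_form ((*v) X) I v d eps st"
    using symplectic_chains_exist[OF assms] .
  let ?p = "\<lambda>\<eta>. card {a \<in> I. d a = \<eta> \<and> eps a = 1}" and ?q = "\<lambda>\<eta>. card {a \<in> I. d a = \<eta> \<and> eps a = - 1}"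
  have t: "count (jordan_partition X) \<eta> = ?p \<eta> + ?q \<eta>" for \<eta> by (rule card_sign_split[OF ch])
  have p: "p_sign X \<eta> = ?p \<eta>" if \<eta>: "\<eta> \<in> even_parts X" for \<eta>
  proof -
    obtain n where n: "\<And>x. (((*v) X) ^^ n) x = 0" using nilpotent_matrixE[OF assms(2)] by blast
    have ev: "even \<eta>" "1 \<le> \<eta>"
      using \<eta> unfolding even_part_iff[OF ch] using symplectic_chains.d_pos[OF ch] by auto
    obtain H Y where "sl2_triple_in sp X H Y" "adapted_basis X H Y \<eta> (v ` {a \<in> I. d a = \<eta>})"
      and cards: "\<And>s. card {b \<in> v ` {a \<in> I. d a = \<eta>}. twisted_form X \<eta> b b = s} =
        card {a \<in> I. d a = \<eta> \<and> eps a = s}"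
      by (rule adapted_basis_chains[OF assms ch \<eta>]) (rule that)
    then show ?thesis using p_sign_eq[OF _ n ev] by simp
  qed
  \<comment> \<open>With the multiplicity written as positive plus negative chains, the
    natural-number subtraction in \<open>q_sign\<close> is exact and leaves the negative
    count.\<close>
  have balanced: "(real (p_sign X \<eta>) = real (count (jordan_partition X) \<eta>) / 2 \<and>
      real (q_sign X \<eta>) = real (count (jordan_partition X) \<eta>) / 2) \<longleftrightarrow> ?p \<eta> = ?q \<eta>"
    if "\<eta> \<in> even_parts X" for \<eta>
    unfolding q_sign_def t p[OF that] by auto
  have "Ad_real Sp X" if "strongly_Ad_real Sp X"
    using that unfolding Ad_real_def strongly_Ad_real_def by blast
  moreover have "?p \<eta> = ?q \<eta>" if "Ad_real Sp X" "\<eta> \<in> even_parts X" for \<eta>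
    using real_imp_balanced[OF assms that(1) ch that(2)] .
  moreover have "strongly_Ad_real Sp X" if bal: "\<forall>\<eta>\<in>even_parts X. ?p \<eta> = ?q \<eta>"
  proof (rule balanced_imp_strongly_real[OF ch])
    fix \<eta> :: nat assume "even \<eta>"
    show "?p \<eta> = ?q \<eta>"
    proof (cases "\<eta> \<in> even_parts X")
      case False
      \<comment> \<open>An even number that is not a part indexes no chain, so the balance required
        for all even lengths is the equality of two empty counts.\<close>
      then have "{a \<in> I. d a = \<eta> \<and> eps a = s} = {}" for s
        using \<open>even \<eta>\<close> even_part_iff[OF ch] by auto
      then show ?thesis by (simp only:)
    qed (use bal in blast)
  qed
  ultimately show ?thesis using balanced by blast
qed

end
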